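(* There is an absolute constant $C>0$ such that the following holds. Let $n\in\mathbb{N}$, $\delta,c\in(0,1]$ with $n\ge C\sqrt{\log\frac{1}{\delta c}}$, let $\mathcal{O}_k:\mathbb{C}^{k\times k}\to\mathbb{C}$ ($1\le k\le n$) be arbitrary oracles, and let $1_k$ be the indicator functions defined in the context. Then either, for every $k\le n$, both (1) $\mathbb{E}_X[1_k(X)]\ge1-\frac{\delta^4c}{64n}$ and (2) $\mathbb{E}_X[1_k(X)\,|\mathcal{O}_k(X)-\mathrm{Per}_k(X)|^2]\le(2nk\delta)^2k!$ hold, or else $\mathsf{PTest}$ (with parameters $n,\delta,c$ and oracle access to $\{\mathcal{O}_k\}$) outputs Reject with probability at least $1-e^{-n}$.
   Context: $\mathrm{Per}_k(X)=\sum_\pi\prod_{i=1}^kx_{i,\pi(i)}$. $\mathbb{E}_X$ is over $X\in\mathbb{C}^{k\times k}$ with i.i.d. standard complex Gaussian entries. $x_{11},\dots,x_{1k}$: first-row entries of $X$; $X_i$: minor deleting first row and $i$-th column. Let $T=\frac{4n}{\delta\sqrt c}$ and $d=\frac{192n^2}{\delta^4c}$. $\mathbb{I}[q]$ is $1$ if $q$ holds and $0$ otherwise. Indicators: $1^{LIN}_1(X)=\mathbb{I}[|\mathcal{O}_1(X)-X|^2\le n^2\delta^2]$; for $2\le k\le n$, $1^{LIN}_k(X)=\mathbb{I}[|\mathcal{O}_k(X)-\sum_ix_{1i}\mathcal{O}_{k-1}(X_i)|^2\le n^2\delta^2k!]$; $1^{TAIL}_k(X)=\mathbb{I}[|\mathcal{O}_k(X)|^2\le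 T^2k!]$; $1^{PERM}_k(X)=\mathbb{I}[|\mathrm{Per}_k(X)|^2\le T^2k!]$; $1_k=1^{LIN}_k\wedge1^{TAIL}_k\wedge1^{PERM}_k$. $\mathsf{LinearityTest}(n,k,\delta)$: sample Gaussian $X\in\mathbb{C}^{k\times k}$; Reject iff $1^{LIN}_k(X)=0$. $\mathsf{TailTest}(k,T)$: sample Gaussian $X$; Reject iff $1^{TAIL}_k(X)=0$. $\mathsf{PTest}$: for each $1\le k\le n$ run $\mathsf{LinearityTest}(n,k,\delta)$ $d$ times and $\mathsf{TailTest}(k,T)$ $d$ times with independent samples; output Accept iff none rejects, otherwise Reject. *)

theory Defs
  imports "HOL-Probability.Probability" "HOL-Combinatorics.Permutations"
begin

text \<open>
  A \<open>k \<times> k\<close> complex matrix is an extensional function on \<open>{1..k} \<times> {1..k}\<close>,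
  i.e. a point of the space of the product measure \<open>gauss_matrix k\<close> below.
\<close>

type_synonym cmatrix = "nat \<times> nat \<Rightarrow> complex"

text \<open>
  The standard complex Gaussian has density \<open>exp (- |z|\<^sup>2) / \<pi>\<close>, so that the expectation of
  \<open>|z|\<^sup>2\<close> is 1.
\<close>

definition complex_gaussian :: "complex measure" where
  "complex_gaussian = density lborel (\<lambda>z. ennreal (exp (- (cmod z)\<^sup>2) / pi))"

definition gauss_matrix :: "nat \<Rightarrow> cmatrix measure" where
  "gauss_matrix k = (\<Pi>\<^sub>M ij \<in> {1..k} \<times> {1..k}. complex_gaussian)"

definition Per :: "nat \<Rightarrow> cmatrix \<Rightarrow> complex" where
  "Per k X = (\<Sum>\<pi> | \<pi> permutes {1..k}. \<Prod>i = 1..k. X (i, \<pi> i))"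

text \<open>The \<open>(k - 1) \<times> (k - 1)\<close> matrix obtained by deleting the first row and the \<open>i\<close>-th column.\<close>

definition row1_minor :: "nat \<Rightarrow> nat \<Rightarrow> cmatrix \<Rightarrow> cmatrix" where
  "row1_minor k i X =
     (\<lambda>(a, b) \<in> {1..k - 1} \<times> {1..k - 1}. X (Suc a, if b < i then b else Suc b))"

definition T_param :: "nat \<Rightarrow> real \<Rightarrow> real \<Rightarrow> real" where
  "T_param n \<delta> c = 4 * real n / (\<delta> * sqrt c)"

definition d_param :: "nat \<Rightarrow> real \<Rightarrow> real \<Rightarrow> real" where
  "d_param n \<delta> c = 192 * (real n)\<^sup>2 / (\<delta> ^ 4 * c)"

text \<open>
  The oracles form a family \<open>\<O>\<close> whose member \<open>\<O> k\<close> is only ever applied to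
  \<open>k \<times> k\<close> matrices.
\<close>

definition LIN :: "nat \<Rightarrow> real \<Rightarrow> (nat \<Rightarrow> cmatrix \<Rightarrow> complex) \<Rightarrow> nat \<Rightarrow> cmatrix \<Rightarrow> bool" where
  "LIN n \<delta> \<O> k X \<longleftrightarrow>
     (if k = 1 then (cmod (\<O> 1 X - X (1, 1)))\<^sup>2 \<le> (real n)\<^sup>2 * \<delta>\<^sup>2
      else (cmod (\<O> k X - (\<Sum>i = 1..k. X (1, i) * \<O> (k - 1) (row1_minor k i X))))\<^sup>2
             \<le> (real n)\<^sup>2 * \<delta>\<^sup>2 * fact k)"

definition TAIL :: "real \<Rightarrow> (nat \<Rightarrow> cmatrix \<Rightarrow> complex) \<Rightarrow> nat \<Rightarrow> cmatrix \<Rightarrow> bool" where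
  "TAIL T \<O> k X \<longleftrightarrow> (cmod (\<O> k X))\<^sup>2 \<le> T\<^sup>2 * fact k"

definition PERM :: "real \<Rightarrow> nat \<Rightarrow> cmatrix \<Rightarrow> bool" where
  "PERM T k X \<longleftrightarrow> (cmod (Per k X))\<^sup>2 \<le> T\<^sup>2 * fact k"

definition ind :: "nat \<Rightarrow> real \<Rightarrow> real \<Rightarrow> (nat \<Rightarrow> cmatrix \<Rightarrow> complex) \<Rightarrow> nat \<Rightarrow> cmatrix \<Rightarrow> real" where
  "ind n \<delta> c \<O> k X =
     of_bool (LIN n \<delta> \<O> k X \<and> TAIL (T_param n \<delta> c) \<O> k X \<and> PERM (T_param n \<delta> c) k X)"

datatype verdict = Accept | Reject

text \<open>The tests as functions of the sampled matrix.\<close>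

definition LinearityTest ::
    "nat \<Rightarrow> nat \<Rightarrow> real \<Rightarrow> (nat \<Rightarrow> cmatrix \<Rightarrow> complex) \<Rightarrow> cmatrix \<Rightarrow> verdict" where
  "LinearityTest n k \<delta> \<O> X = (if LIN n \<delta> \<O> k X then Accept else Reject)"

definition TailTest :: "nat \<Rightarrow> real \<Rightarrow> (nat \<Rightarrow> cmatrix \<Rightarrow> complex) \<Rightarrow> cmatrix \<Rightarrow> verdict" where
  "TailTest k T \<O> X = (if TAIL T \<O> k X then Accept else Reject)"

text \<open>
  The number \<open>d_param n \<delta> c\<close> of repetitions need not be an integer; it is rounded up.
\<close>

definition num_runs :: "nat \<Rightarrow> real \<Rightarrow> real \<Rightarrow> nat" where
  "num_runs n \<delta> c = nat \<lceil>d_param n \<delta> c\<rceil>"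

datatype test_kind = Linearity | Tail

text \<open>
  The joint law of all samples drawn during one execution of the test: the coordinate
  \<open>(t, k, j)\<close> is the \<open>k \<times> k\<close> Gaussian matrix sampled in the \<open>j\<close>-th run of the test of kind \<open>t\<close>
  at level \<open>k\<close>; distinct coordinates are independent.
\<close>

definition PTest_samples ::
    "nat \<Rightarrow> real \<Rightarrow> real \<Rightarrow> (test_kind \<times> nat \<times> nat \<Rightarrow> cmatrix) measure" where
  "PTest_samples n \<delta> c =
     (\<Pi>\<^sub>M (t, k, j) \<in> {Linearity, Tail} \<times> {1..n} \<times> {..<num_runs n \<delta> c}. gauss_matrix k)"

definition PTest ::
    "nat \<Rightarrow> real \<Rightarrow> real \<Rightarrow> (nat \<Rightarrow> cmatrix \<Rightarrow> complex) \<Rightarrow> (test_kind \<times> nat \<times> nat \<Rightarrow> cmatrix) \<Rightarrow> verdict"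
  where
  "PTest n \<delta> c \<O> \<omega> =
     (if \<forall>k\<in>{1..n}. \<forall>j<num_runs n \<delta> c.
           LinearityTest n k \<delta> \<O> (\<omega> (Linearity, k, j)) = Accept \<and>
           TailTest k (T_param n \<delta> c) \<O> (\<omega> (Tail, k, j)) = Accept
      then Accept else Reject)"

end

theory Submission
  imports Defs
begin

text \<open>
  Suppose the test rejects with probability below \<open>1 - e\<^sup>-\<^sup>n\<close>. All runs are independent, so it
  accepts with probability at most \<open>exp (- d \<Sigma>)\<close>, where \<open>\<Sigma>\<close> is the sum of the linearity and tail
  failure probabilities over all levels; hence \<open>\<Sigma> \<le> n / d = \<delta>\<^sup>4 c / (192 n)\<close>. The permanent obeys
  the tail bound by Markov's inequality for the fourth moment, \<open>E |Per\<^sub>k|\<^sup>4 = (k + 1) (k!)\<^sup>2\<close>: Wick's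
  formula in each row turns the fourth moment into a sum, over the set \<open>S\<close> of rows with the straight
  pairing, of the number of compatible quadruples of permutations, that is \<open>k! |S|! (k - |S|)!\<close>.
  This gives (1).

  For (2), induct on \<open>k\<close>. Expanding along the first row, the error at level \<open>k\<close> is the linearity
  defect plus a linear form in the independent first row whose coefficients are the errors on the
  minors. If all minors are good, orthogonality of the row entries adds \<open>n \<delta>\<close> to the normalised
  \<open>L\<^sup>2\<close> error; otherwise the tail bounds give at most \<open>4 T\<^sup>2 k!\<close> on an event of probability
  \<open>k \<delta>\<^sup>4 c / (64 n)\<close>.
\<close>

section \<open>Moments of complex Gaussians\<close>

definition normal_moment :: "nat \<Rightarrow> real" where
  "normal_moment p = (if even p then fact p / (2 ^ p * fact (p div 2)) else 0)"

lemma has_bochner_integral_normal_moment: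
  "has_bochner_integral lborel (\<lambda>x. exp (- x\<^sup>2) / sqrt pi * x ^ p) (normal_moment p)"
proof -
  have density: "normal_density 0 (1 / sqrt 2) x = exp (- x\<^sup>2) / sqrt pi" for x
    by (simp add: normal_density_def power_divide field_simps)
  show ?thesis
  proof (cases "even p")
    case True
    then obtain k where "p = 2 * k" by blast
    with normal_moment_even[of "1 / sqrt 2" 0 k] show ?thesis
      by (simp add: density normal_moment_def power_divide power_mult)
  next
    case False
    then obtain k where "p = 2 * k + 1" by (auto elim: oddE)
    with normal_moment_odd[of "1 / sqrt 2" 0 k] show ?thesis
      by (simp add: density normal_moment_def)
  qed
qed

lemma binomial_normal_moment:
  assumes "i \<le> m"
  shows "real ((2 * m) choose (2 * i)) * (normal_moment (2 * i) * normal_moment (2 * (m - i))) =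
    normal_moment (2 * m) * real (m choose i)"
proof -
  have "2 * m - 2 * i = 2 * (m - i)" by simp
  moreover have "(2::real) ^ (2 * i) * 2 ^ (2 * (m - i)) = 2 ^ (2 * m)"
    using assms by (simp flip: power_add)
  ultimately show ?thesis
    using assms
    by (simp add: normal_moment_def binomial_fact field_simps power_add[symmetric])
qed

lemma sum_binomial_normal_moment:
  fixes x y :: complex
  shows "(\<Sum>k\<le>n. of_nat (n choose k) * of_real (normal_moment k * normal_moment (n - k)) *
      (x ^ k * y ^ (n - k))) = of_real (normal_moment n) * (x\<^sup>2 + y\<^sup>2) ^ (n div 2)"
    (is "(\<Sum>k\<le>n. ?t k) = _")
proof (cases "even n")
  case False
  then have "?t k = 0" if "k \<le> n" for k
    using that by (simp add: normal_moment_def)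
  then have "(\<Sum>k\<le>n. ?t k) = 0" by (intro sum.neutral) simp
  with False show ?thesis by (simp add: normal_moment_def)
next
  case True
  then obtain m where n: "n = 2 * m" by blast
  have even_term: "?t (2 * i) =
      of_real (normal_moment n) * (of_nat (m choose i) * (x\<^sup>2) ^ i * (y\<^sup>2) ^ (m - i))"
    if "i \<le> m" for i
  proof -
    have "?t (2 * i) = of_real (real ((2 * m) choose (2 * i)) *
        (normal_moment (2 * i) * normal_moment (2 * (m - i)))) * ((x\<^sup>2) ^ i * (y\<^sup>2) ^ (m - i))"
      by (simp add: n power_mult flip: diff_mult_distrib2)
    with binomial_normal_moment[OF that] show ?thesis by (simp add: n)
  qed
  have "(\<Sum>k\<le>n. ?t k) = (\<Sum>k\<le>Suc (2 * m). ?t k)" by (simp add: n)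
  also have "\<dots> = (\<Sum>i\<le>m. ?t (2 * i))"
    unfolding sum.in_pairs_0 by (simp add: normal_moment_def)
  also have "\<dots> = of_real (normal_moment n) * (x\<^sup>2 + y\<^sup>2) ^ m"
    unfolding binomial_ring sum_distrib_left using even_term by simp
  finally show ?thesis by (simp add: n)
qed

lemma has_bochner_integral_complex_gaussian_Re_Im:
  "has_bochner_integral complex_gaussian (\<lambda>z. Re z ^ p * Im z ^ q)
     (normal_moment p * normal_moment q)"
proof -
  interpret product_sigma_finite "\<lambda>_::complex. lborel :: real measure" by standard
  define e where "e b = (if b = (1::complex) then p else q)" for b
  define f where "f b x = exp (- x\<^sup>2) / sqrt pi * x ^ e b" for b and x :: real
  have f: "has_bochner_integral lborel (f b) (normal_moment (e b))" for b
    unfolding f_def by (rule has_bochner_integral_normal_moment)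
  have "has_bochner_integral (\<Pi>\<^sub>M b\<in>Basis. lborel) (\<lambda>x. \<Prod>b\<in>Basis. f b (x b))
      (\<Prod>b\<in>Basis. normal_moment (e b))"
    using f product_integrable_prod[of Basis f] product_integral_prod[of Basis f]
    by (auto simp: has_bochner_integral_iff)
  also have "(\<lambda>x. \<Prod>b\<in>Basis. f b (x b)) =
      (\<lambda>x. (\<lambda>z. \<Prod>b\<in>Basis. f b (z \<bullet> b)) (\<Sum>b\<in>Basis. x b *\<^sub>R b))"
    by (auto intro!: prod.cong simp: inner_sum_left_Basis)
  finally have "has_bochner_integral lborel (\<lambda>z. \<Prod>b\<in>Basis. f b (z \<bullet> b))
      (\<Prod>b\<in>Basis. normal_moment (e b))"
    by (subst lborel_eq, intro has_bochner_integral_distr) (auto simp: f_def)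
  also have "(\<lambda>z. \<Prod>b\<in>Basis. f b (z \<bullet> b)) =
      (\<lambda>z. (exp (- (cmod z)\<^sup>2) / pi) *\<^sub>R (Re z ^ p * Im z ^ q))"
    by (auto simp: Basis_complex_def f_def e_def fun_eq_iff cmod_power2 exp_add[symmetric]
        complex_eq_iff field_simps)
  also have "(\<Prod>b\<in>Basis. normal_moment (e b)) = normal_moment p * normal_moment q"
    by (simp add: Basis_complex_def e_def complex_eq_iff)
  finally show ?thesis
    unfolding complex_gaussian_def by (intro has_bochner_integral_density) auto
qed

lemmas has_bochner_integral_complex_gaussian_of_real_Re_Im =
  has_bochner_integral_of_real[OF has_bochner_integral_complex_gaussian_Re_Im, where 'a = complex]

lemma has_bochner_integral_complex_gaussian_linear_power:
  fixes \<alpha> \<beta> :: complex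
  shows "has_bochner_integral complex_gaussian (\<lambda>z. (\<alpha> * of_real (Re z) + \<beta> * of_real (Im z)) ^ n)
    (of_real (normal_moment n) * (\<alpha>\<^sup>2 + \<beta>\<^sup>2) ^ (n div 2))"
proof -
  have "has_bochner_integral complex_gaussian
      (\<lambda>z. \<Sum>k\<le>n. of_nat (n choose k) * (\<alpha> ^ k * \<beta> ^ (n - k)) * of_real (Re z ^ k * Im z ^ (n - k)))
      (\<Sum>k\<le>n. of_nat (n choose k) * (\<alpha> ^ k * \<beta> ^ (n - k)) *
        of_real (normal_moment k * normal_moment (n - k)))"
    by (intro has_bochner_integral_sum has_bochner_integral_mult_right
        has_bochner_integral_complex_gaussian_of_real_Re_Im)
  then show ?thesis
    unfolding binomial_ring[of "_ * _"] sum_binomial_normal_moment[symmetric]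
    by (simp add: power_mult_distrib mult_ac)
qed

lemma integrable_complex_gaussian_power_cnj_power:
  "integrable complex_gaussian (\<lambda>z. z ^ a * cnj z ^ b)"
proof -
  have binomial: "z ^ a * cnj z ^ b = (\<Sum>i\<le>a. \<Sum>j\<le>b.
      (of_nat (a choose i) * of_nat (b choose j) * (\<i> ^ (a - i) * (- \<i>) ^ (b - j))) *
      of_real (Re z ^ (i + j) * Im z ^ ((a - i) + (b - j))))" for z
  proof -
    have "z ^ a * cnj z ^ b =
        (of_real (Re z) + \<i> * of_real (Im z)) ^ a * (of_real (Re z) + (- \<i>) * of_real (Im z)) ^ b"
      by (intro arg_cong2[where f = "(*)"] arg_cong[where f = "\<lambda>w. w ^ _"])
        (simp_all add: complex_eq_iff)
    then show ?thesis
      by (simp only: binomial_ring sum_product power_mult_distrib power_add of_real_mult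
          of_real_power mult_ac)
  qed
  show ?thesis
    unfolding binomial
    by (intro Bochner_Integration.integrable_sum integrable_mult_right
        has_bochner_integral_complex_gaussian_of_real_Re_Im[THEN integrable.intros])
qed

text \<open>
  The mixed moments of \<open>z\<close> and \<open>cnj z\<close> are the coefficients of this polynomial in \<open>s\<close>.
\<close>

lemma has_bochner_integral_complex_gaussian_add_cnj_power:
  "has_bochner_integral complex_gaussian (\<lambda>z. (s * z + cnj z) ^ n)
    (of_real (normal_moment n) * (4 * s) ^ (n div 2))"
proof -
  have "s * z + cnj z = (s + 1) * of_real (Re z) + \<i> * (s - 1) * of_real (Im z)" for z
    by (simp add: complex_eq_iff algebra_simps)
  moreover have "(s + 1)\<^sup>2 + (\<i> * (s - 1))\<^sup>2 = 4 * s"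
    by (simp add: power2_eq_square algebra_simps)
  ultimately show ?thesis
    using has_bochner_integral_complex_gaussian_linear_power[of "s + 1" "\<i> * (s - 1)" n] by simp
qed

lemma sum_binomial_complex_gaussian_moment:
  "(\<Sum>k\<le>n. of_nat (n choose k) * (\<integral>z. z ^ k * cnj z ^ (n - k) \<partial>complex_gaussian) * s ^ k) =
    of_real (normal_moment n) * (4 * s) ^ (n div 2)"
proof -
  have "(\<Sum>k\<le>n. of_nat (n choose k) * (\<integral>z. z ^ k * cnj z ^ (n - k) \<partial>complex_gaussian) * s ^ k) =
      (\<integral>z. (\<Sum>k\<le>n. of_nat (n choose k) * s ^ k * (z ^ k * cnj z ^ (n - k))) \<partial>complex_gaussian)"
    by (subst Bochner_Integration.integral_sum)
      (simp_all add: integrable_complex_gaussian_power_cnj_power mult.assoc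
        mult.commute[of _ "s ^ _"])
  also have "\<dots> = (\<integral>z. (s * z + cnj z) ^ n \<partial>complex_gaussian)"
    unfolding binomial_ring by (simp add: power_mult_distrib mult_ac)
  finally show ?thesis
    using has_bochner_integral_complex_gaussian_add_cnj_power
    by (simp only: has_bochner_integral_integral_eq)
qed

lemma has_bochner_integral_complex_gaussian_moment:
  "has_bochner_integral complex_gaussian (\<lambda>z. z ^ a * cnj z ^ b) (if a = b then fact a else 0)"
proof -
  define \<mu> where "\<mu> a b = (\<integral>z. z ^ a * cnj z ^ b \<partial>complex_gaussian)" for a b
  let ?n = "a + b"
  let ?d = "\<lambda>k. if 2 * k = ?n then of_real (normal_moment ?n) * 4 ^ k else 0 :: complex"
  have "of_real (normal_moment ?n) * (4 * s) ^ (?n div 2) = (\<Sum>k\<le>?n. ?d k * s ^ k)" for s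
  proof (cases "even ?n")
    case True
    then have "?d k * s ^ k =
        (if k = ?n div 2 then of_real (normal_moment ?n) * (4 * s) ^ k else 0)" for k
      by (auto simp: power_mult_distrib)
    then show ?thesis by simp
  next
    case False
    then have "?d k = 0" for k by (simp add: normal_moment_def)
    with False show ?thesis by (simp add: normal_moment_def)
  qed
  then have "\<forall>k\<le>?n. of_nat (?n choose k) * \<mu> k (?n - k) = ?d k"
    by (subst polyfun_eq_coeffs[symmetric]) (simp add: \<mu>_def sum_binomial_complex_gaussian_moment)
  from this[rule_format, of a] have "of_nat (?n choose a) * \<mu> a b = ?d a" by simp
  moreover have "of_real (normal_moment (2 * a)) * 4 ^ a =
      of_nat ((2 * a) choose a) * (fact a :: complex)"
    by (simp add: normal_moment_def binomial_fact power_mult power_divide)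
  ultimately have "\<mu> a b = (if a = b then fact a else 0)"
    by (auto simp: mult_2[symmetric])
  with integrable_complex_gaussian_power_cnj_power[of a b] show ?thesis
    by (simp add: has_bochner_integral_iff \<mu>_def)
qed

lemma sets_complex_gaussian [measurable_cong]: "sets complex_gaussian = sets borel"
  by (simp add: complex_gaussian_def)

lemma prob_space_complex_gaussian: "prob_space complex_gaussian"
proof
  have "has_bochner_integral complex_gaussian (\<lambda>_. 1 :: complex) 1"
    using has_bochner_integral_complex_gaussian_moment[of 0 0] by simp
  then have "measure complex_gaussian (space complex_gaussian) = 1"
    by (simp add: has_bochner_integral_iff scaleR_conv_of_real)
  then show "emeasure complex_gaussian (space complex_gaussian) = 1"
    by (cases "emeasure complex_gaussian (space complex_gaussian) = \<infinity>")
      (simp_all add: measure_def emeasure_eq_ennreal_measure)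
qed

lemma prob_space_gauss_matrix: "prob_space (gauss_matrix k)"
  unfolding gauss_matrix_def by (intro prob_space_PiM prob_space_complex_gaussian)

lemma has_bochner_integral_PiM_gaussian_monomial:
  assumes J: "finite J"
  shows "has_bochner_integral (\<Pi>\<^sub>M x\<in>J. complex_gaussian) (\<lambda>X. \<Prod>x\<in>J. X x ^ e x * cnj (X x) ^ f x)
    (\<Prod>x\<in>J. if e x = f x then fact (e x) else 0)"
proof -
  interpret prob_space complex_gaussian by (rule prob_space_complex_gaussian)
  interpret product_sigma_finite "\<lambda>_. complex_gaussian" by standard
  let ?g = "\<lambda>x z. z ^ e x * cnj z ^ f x"
  note moment = has_bochner_integral_complex_gaussian_moment
  note integrable = integrable.intros[OF moment]
  show ?thesis
    using product_integrable_prod[OF J integrable] product_integral_prod[OF J integrable]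
    by (simp add: has_bochner_integral_iff has_bochner_integral_integral_eq[OF moment])
qed

lemma prod_mset_eq_prod_power_count:
  fixes g :: "'a \<Rightarrow> 'b::comm_monoid_mult"
  assumes "finite J" "set_mset A \<subseteq> J"
  shows "(\<Prod>j\<in>#A. g j) = (\<Prod>j\<in>J. g j ^ count A j)"
  unfolding image_prod_mset_multiplicity
  using assms by (intro prod.mono_neutral_left) (auto simp: not_in_iff)

definition gaussian_mset_moment :: "'a multiset \<Rightarrow> 'a multiset \<Rightarrow> nat" where
  "gaussian_mset_moment A B = (if A = B then \<Prod>j\<in>set_mset A. fact (count A j) else 0)"

lemma gaussian_mset_moment_eq_prod:
  assumes J: "finite J" "set_mset A \<subseteq> J" "set_mset B \<subseteq> J"
  shows "(\<Prod>j\<in>J. if count A j = count B j then fact (count A j) else 0) =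
    (of_nat (gaussian_mset_moment A B) :: 'b::{comm_semiring_1, semiring_char_0})"
proof (cases "A = B")
  case True
  have "(\<Prod>j\<in>J. fact (count A j) :: 'b) = (\<Prod>j\<in>set_mset A. fact (count A j))"
    using J by (intro prod.mono_neutral_right) (auto simp: not_in_iff)
  with True show ?thesis by (simp add: gaussian_mset_moment_def)
next
  case False
  then obtain j where "count A j \<noteq> count B j" by (auto simp: multiset_eq_iff)
  moreover from this have "j \<in> J" using J by (metis not_in_iff subsetD)
  ultimately show ?thesis
    using J False by (auto simp: gaussian_mset_moment_def intro!: prod_zero bexI[of _ j])
qed

lemma has_bochner_integral_gaussian_mset:
  assumes "finite J" "set_mset A \<subseteq> J" "set_mset B \<subseteq> J"
  shows "has_bochner_integral (\<Pi>\<^sub>M j\<in>J. complex_gaussian)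
    (\<lambda>X. (\<Prod>j\<in>#A. X j) * (\<Prod>j\<in>#B. cnj (X j))) (of_nat (gaussian_mset_moment A B))"
  using has_bochner_integral_PiM_gaussian_monomial[OF assms(1), of "count A" "count B"] assms
  by (simp add: prod_mset_eq_prod_power_count[of J] gaussian_mset_moment_eq_prod[of J, symmetric]
      prod.distrib)

lemma has_bochner_integral_gaussian_rows:
  assumes "finite I" "finite J" "\<And>i. i \<in> I \<Longrightarrow> set_mset (A i) \<subseteq> J" "\<And>i. i \<in> I \<Longrightarrow> set_mset (B i) \<subseteq> J"
  shows "has_bochner_integral (\<Pi>\<^sub>M x\<in>I \<times> J. complex_gaussian)
    (\<lambda>X. \<Prod>i\<in>I. (\<Prod>j\<in>#A i. X (i, j)) * (\<Prod>j\<in>#B i. cnj (X (i, j))))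
    (of_nat (\<Prod>i\<in>I. gaussian_mset_moment (A i) (B i)))"
proof -
  let ?e = "\<lambda>x. count (A (fst x)) (snd x)" and ?f = "\<lambda>x. count (B (fst x)) (snd x)"
  have "(\<Prod>x\<in>I \<times> J. X x ^ ?e x * cnj (X x) ^ ?f x) =
      (\<Prod>i\<in>I. (\<Prod>j\<in>#A i. X (i, j)) * (\<Prod>j\<in>#B i. cnj (X (i, j))))" for X
    using assms
    by (simp add: prod_mset_eq_prod_power_count[of J] prod.distrib prod.cartesian_product split_beta)
  moreover have "(\<Prod>x\<in>I \<times> J. if ?e x = ?f x then fact (?e x) else 0) =
      (of_nat (\<Prod>i\<in>I. gaussian_mset_moment (A i) (B i)) :: complex)"
    using assms
    by (simp add: gaussian_mset_moment_eq_prod[of J, symmetric] prod.cartesian_product split_beta)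
  ultimately show ?thesis
    using has_bochner_integral_PiM_gaussian_monomial[of "I \<times> J" ?e ?f] assms(1,2) by simp
qed

lemma has_bochner_integral_gaussian_linear_form:
  fixes c :: "'a \<Rightarrow> complex"
  assumes J: "finite J"
  shows "has_bochner_integral (\<Pi>\<^sub>M j\<in>J. complex_gaussian) (\<lambda>y. (cmod (\<Sum>j\<in>J. y j * c j))\<^sup>2)
    (\<Sum>j\<in>J. (cmod (c j))\<^sup>2)"
proof -
  let ?M = "\<Pi>\<^sub>M j\<in>J. complex_gaussian"
  have orthonormal: "has_bochner_integral ?M (\<lambda>y. y j * cnj (y l)) (of_bool (j = l))"
    if "j \<in> J" "l \<in> J" for j l
    using has_bochner_integral_gaussian_mset[OF J, of "{#j#}" "{#l#}"] that
    by (auto simp: gaussian_mset_moment_def of_bool_def split: if_splits)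
  have "has_bochner_integral ?M (\<lambda>y. \<Sum>j\<in>J. \<Sum>l\<in>J. (c j * cnj (c l)) * (y j * cnj (y l)))
      (\<Sum>j\<in>J. \<Sum>l\<in>J. (c j * cnj (c l)) * of_bool (j = l))"
    by (intro has_bochner_integral_sum has_bochner_integral_mult_right orthonormal)
  also have "(\<lambda>y. \<Sum>j\<in>J. \<Sum>l\<in>J. (c j * cnj (c l)) * (y j * cnj (y l))) =
      (\<lambda>y. complex_of_real ((cmod (\<Sum>j\<in>J. y j * c j))\<^sup>2))"
    unfolding complex_norm_square cnj_sum sum_product by (simp add: mult_ac)
  also have "(\<Sum>j\<in>J. \<Sum>l\<in>J. (c j * cnj (c l)) * of_bool (j = l)) =
      complex_of_real (\<Sum>j\<in>J. (cmod (c j))\<^sup>2)"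
    using J by (simp add: of_bool_def if_distrib cong: if_cong flip: complex_norm_square)
  finally show ?thesis
    using has_bochner_integral_bounded_linear[OF bounded_linear_Re] by fastforce
qed

section \<open>The fourth moment of the permanent\<close>

lemma sum_Pow_fact_card:
  assumes "finite I"
  shows "(\<Sum>S\<in>Pow I. fact (card S) * fact (card I - card S) :: nat) = Suc (card I) * fact (card I)"
proof -
  have "(\<Sum>S\<in>Pow I. fact (card S) * fact (card I - card S) :: nat) =
      (\<Sum>s\<in>{..card I}. \<Sum>S | S \<in> Pow I \<and> card S = s. fact (card S) * fact (card I - card S))"
    using assms by (intro sum.group[symmetric]) (auto intro: card_mono)
  also have "\<dots> = (\<Sum>s\<in>{..card I}. fact (card I))"
    using assms
    by (intro sum.cong) (auto simp: n_subsets mult.commute[of _ "_ * _"] binomial_fact_lemma)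
  finally show ?thesis by simp
qed

text \<open>
  Wick's formula pairs each unconjugated entry of a row with a conjugated one; \<open>S\<close> is the set of rows
  in which the pairing is straight rather than crossed.
\<close>

definition paired_permutations ::
    "'a set \<Rightarrow> 'a set \<Rightarrow> (('a \<Rightarrow> 'a) \<times> ('a \<Rightarrow> 'a) \<times> ('a \<Rightarrow> 'a) \<times> ('a \<Rightarrow> 'a)) set" where
  "paired_permutations I S = {(p, q, r, s).
     p permutes I \<and> q permutes I \<and> r permutes I \<and> s permutes I \<and>
     (\<forall>i\<in>S. p i = r i \<and> q i = s i) \<and> (\<forall>i\<in>I - S. p i = s i \<and> q i = r i)}"

lemma paired_permutationsI:
  assumes "S \<subseteq> I" and p: "p permutes I" and \<sigma>: "\<sigma> permutes S" and \<tau>: "\<tau> permutes (I - S)"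
  shows "(p, p \<circ> \<sigma> \<circ> \<tau>, p \<circ> \<tau>, p \<circ> \<sigma>) \<in> paired_permutations I S"
proof -
  have "\<sigma> permutes I" "\<tau> permutes I"
    using \<sigma> \<tau> assms(1) by (auto intro: permutes_subset)
  moreover have "\<tau> i = i" if "i \<in> S" for i
    using permutes_not_in[OF \<tau>] that by simp
  moreover have "\<sigma> i = i" "\<sigma> (\<tau> i) = \<tau> i" if "i \<in> I - S" for i
    using permutes_not_in[OF \<sigma>] permutes_in_image[OF \<tau>, of i] that by auto
  ultimately show ?thesis
    using p by (simp add: paired_permutations_def permutes_compose)
qed

lemma paired_permutations_factor:
  assumes "S \<subseteq> I" "(p, q, r, s) \<in> paired_permutations I S"
  shows "inv p \<circ> s permutes S" "inv p \<circ> r permutes (I - S)" "p \<circ> (inv p \<circ> s) \<circ> (inv p \<circ> r) = q"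
proof -
  have perm: "p permutes I" "q permutes I" "r permutes I" "s permutes I"
    and straight_row: "\<And>i. i \<in> S \<Longrightarrow> r i = p i \<and> s i = q i"
    and crossed_row: "\<And>i. i \<in> I - S \<Longrightarrow> s i = p i \<and> r i = q i"
    using assms(2) by (auto simp: paired_permutations_def)
  have inv_p: "p (inv p i) = i" "inv p (p i) = i" for i
    using permutes_inverses[OF perm(1)] by auto
  show "inv p \<circ> s permutes S"
    by (rule permutes_superset[OF permutes_compose[OF perm(4) permutes_inv[OF perm(1)]]])
      (simp add: crossed_row inv_p)
  show \<tau>: "inv p \<circ> r permutes (I - S)"
    by (rule permutes_superset[OF permutes_compose[OF perm(3) permutes_inv[OF perm(1)]]])
      (use assms(1) in \<open>auto simp: straight_row inv_p\<close>)
  have "s (inv p (r i)) = q i" for i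
  proof -
    consider (straight) "i \<in> S" | (crossed) "i \<in> I - S" | (outside) "i \<notin> I" by blast
    then show ?thesis
    proof cases
      case straight
      then show ?thesis by (simp add: straight_row inv_p)
    next
      case crossed
      then have "inv p (r i) \<in> I - S" using permutes_in_image[OF \<tau>, of i] by simp
      then have "s (inv p (r i)) = r i" using crossed_row by (simp add: inv_p)
      with crossed show ?thesis using crossed_row by simp
    next
      case outside
      then show ?thesis
        using permutes_not_in[OF perm(2)] permutes_not_in[OF perm(3)] permutes_not_in[OF perm(4)]
          permutes_not_in[OF permutes_inv[OF perm(1)]] by simp
    qed
  qed
  then show "p \<circ> (inv p \<circ> s) \<circ> (inv p \<circ> r) = q"
    by (simp add: fun_eq_iff inv_p)
qed

lemma card_paired_permutations:
  assumes "finite I" "S \<subseteq> I"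
  shows "card (paired_permutations I S) = fact (card I) * (fact (card S) * fact (card I - card S))"
proof -
  let ?D = "{p. p permutes I} \<times> {\<sigma>. \<sigma> permutes S} \<times> {\<tau>. \<tau> permutes (I - S)}"
  let ?f = "\<lambda>(p, \<sigma>, \<tau>). (p, p \<circ> \<sigma> \<circ> \<tau>, p \<circ> \<tau>, p \<circ> \<sigma>)"
  let ?g = "\<lambda>(p, q, r, s). (p, inv p \<circ> s, inv p \<circ> r)"
  have "bij_betw ?f ?D (paired_permutations I S)"
  proof (rule bij_betw_byWitness[where f' = ?g])
    show "\<forall>x\<in>?D. ?g (?f x) = x"
      by (auto simp: o_assoc permutes_inv_o)
    show "?f ` ?D \<subseteq> paired_permutations I S"
      using paired_permutationsI[OF assms(2)] by auto
    have "?f (?g x) = x \<and> ?g x \<in> ?D" if "x \<in> paired_permutations I S" for x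
    proof -
      obtain p q r s where x: "x = (p, q, r, s)" by (cases x)
      have p: "p permutes I" using that by (simp add: x paired_permutations_def)
      then have "p \<circ> (inv p \<circ> r) = r" "p \<circ> (inv p \<circ> s) = s"
        by (simp_all add: o_assoc permutes_inv_o)
      with p paired_permutations_factor[OF assms(2) that[unfolded x]] show ?thesis by (simp add: x)
    qed
    then show "\<forall>x\<in>paired_permutations I S. ?f (?g x) = x" "?g ` paired_permutations I S \<subseteq> ?D"
      by blast+
  qed
  then have "card (paired_permutations I S) = card ?D" by (simp add: bij_betw_same_card)
  also have "\<dots> = fact (card I) * (fact (card S) * fact (card I - card S))"
    using assms finite_subset[of S I]
    by (simp add: card_cartesian_product card_permutations[OF refl] card_Diff_subset)
  finally show ?thesis .
qed

lemma gaussian_mset_moment_pairs: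
  "gaussian_mset_moment {#a, b#} {#c, d#} = of_bool (a = c \<and> b = d) + of_bool (a = d \<and> b = c)"
proof -
  have "{#a, b#} = {#c, d#} \<longleftrightarrow> a = c \<and> b = d \<or> a = d \<and> b = c"
    by (auto simp: add_eq_conv_diff split: if_splits)
  moreover have "(\<Prod>j\<in>set_mset {#a, b#}. fact (count {#a, b#} j)) = (if a = b then 2 else 1 :: nat)"
    by simp
  ultimately show ?thesis
    unfolding gaussian_mset_moment_def by simp
qed

lemma prod_gaussian_mset_moment_pairs:
  assumes "finite I"
  shows "(\<Prod>i\<in>I. gaussian_mset_moment {#p i, q i#} {#r i, s i#}) =
    (\<Sum>S\<in>Pow I. of_bool ((\<forall>i\<in>S. p i = r i \<and> q i = s i) \<and> (\<forall>i\<in>I - S. p i = s i \<and> q i = r i)))"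
proof -
  have prod_of_bool: "(\<Prod>i\<in>A. of_bool (R i)) = (of_bool (\<forall>i\<in>A. R i) :: nat)" if "finite A" for A R
    using that by induction auto
  show ?thesis
    unfolding gaussian_mset_moment_pairs prod_add[OF assms]
    using assms by (intro sum.cong refl) (simp add: prod_of_bool finite_subset)
qed

lemma sum_permutations_gaussian_mset_moment:
  fixes I :: "'a set"
  assumes "finite I"
  shows "(\<Sum>p | p permutes I. \<Sum>q | q permutes I. \<Sum>r | r permutes I. \<Sum>s | s permutes I.
      \<Prod>i\<in>I. gaussian_mset_moment {#p i, q i#} {#r i, s i#}) = Suc (card I) * (fact (card I))\<^sup>2"
proof -
  let ?P = "{p. p permutes I}"
  let ?paired = "\<lambda>S (p, q, r, s).
    (\<forall>i\<in>S. p i = r i \<and> q i = s i) \<and> (\<forall>i\<in>I - S. p i = s i \<and> q i = r i)"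
  have "(\<Sum>p\<in>?P. \<Sum>q\<in>?P. \<Sum>r\<in>?P. \<Sum>s\<in>?P. \<Prod>i\<in>I. gaussian_mset_moment {#p i, q i#} {#r i, s i#}) =
      (\<Sum>(p, q, r, s)\<in>?P \<times> ?P \<times> ?P \<times> ?P.
        \<Prod>i\<in>I. gaussian_mset_moment {#p i, q i#} {#r i, s i#})"
    by (simp add: sum.cartesian_product)
  also have "\<dots> = (\<Sum>x\<in>?P \<times> ?P \<times> ?P \<times> ?P. \<Sum>S\<in>Pow I. of_bool (?paired S x))"
    by (simp add: prod_gaussian_mset_moment_pairs[OF assms] split_beta)
  also have "\<dots> = (\<Sum>S\<in>Pow I. \<Sum>x\<in>?P \<times> ?P \<times> ?P \<times> ?P. of_bool (?paired S x))"
    by (rule sum.swap)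
  also have "\<dots> = (\<Sum>S\<in>Pow I. card (paired_permutations I S))"
    using assms
    by (intro sum.cong refl)
      (auto simp: paired_permutations_def finite_permutations intro!: arg_cong[where f = card])
  also have "\<dots> = fact (card I) * (Suc (card I) * fact (card I))"
    using assms
    by (simp add: card_paired_permutations sum_Pow_fact_card del: mult_Suc flip: sum_distrib_left)
  finally show ?thesis by (simp add: power2_eq_square mult_ac del: mult_Suc)
qed

lemma norm_Per_power4_eq_sum:
  "complex_of_real (cmod (Per k X) ^ 4) =
    (\<Sum>p | p permutes {1..k}. \<Sum>q | q permutes {1..k}. \<Sum>r | r permutes {1..k}. \<Sum>s | s permutes {1..k}.
      \<Prod>i = 1..k. X (i, p i) * X (i, q i) * (cnj (X (i, r i)) * cnj (X (i, s i))))"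
    (is "_ = ?rhs")
proof -
  have "?rhs = Per k X * Per k X * (cnj (Per k X) * cnj (Per k X))"
    unfolding prod.distrib Per_def
    by (simp only: sum_distrib_left[symmetric] sum_distrib_right[symmetric] cnj_sum cnj_prod)
  also have "\<dots> = (Per k X * cnj (Per k X))\<^sup>2"
    by (simp add: power2_eq_square)
  also have "\<dots> = complex_of_real (cmod (Per k X) ^ 4)"
    unfolding complex_norm_square[symmetric] by (simp flip: power_mult)
  finally show ?thesis by (rule sym)
qed

lemma has_bochner_integral_norm_Per_power4:
  "has_bochner_integral (gauss_matrix k) (\<lambda>X. cmod (Per k X) ^ 4) (real (Suc k) * (fact k)\<^sup>2)"
proof -
  let ?P = "{p. p permutes {1..k}}"
  let ?wick = "\<lambda>p q r s. \<Prod>i = 1..k. gaussian_mset_moment {#p i, q i#} {#r i, s i#}"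
  have wick: "has_bochner_integral (gauss_matrix k)
      (\<lambda>X. \<Prod>i = 1..k. X (i, p i) * X (i, q i) * (cnj (X (i, r i)) * cnj (X (i, s i))))
      (of_nat (?wick p q r s))"
    if "p \<in> ?P" "q \<in> ?P" "r \<in> ?P" "s \<in> ?P" for p q r s
  proof -
    have subset: "set_mset {#u i, v i#} \<subseteq> {1..k}" if "u \<in> ?P" "v \<in> ?P" "i \<in> {1..k}" for u v i
      using permutes_in_image[of u "{1..k}" i] permutes_in_image[of v "{1..k}" i] that by simp
    have "has_bochner_integral (gauss_matrix k)
        (\<lambda>X. \<Prod>i = 1..k. (\<Prod>j\<in>#{#p i, q i#}. X (i, j)) * (\<Prod>j\<in>#{#r i, s i#}. cnj (X (i, j))))
        (of_nat (?wick p q r s))"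
      unfolding gauss_matrix_def
      by (intro has_bochner_integral_gaussian_rows subset that finite_atLeastAtMost)
    then show ?thesis by simp
  qed
  have "has_bochner_integral (gauss_matrix k) (\<lambda>X. complex_of_real (cmod (Per k X) ^ 4))
      (\<Sum>p\<in>?P. \<Sum>q\<in>?P. \<Sum>r\<in>?P. \<Sum>s\<in>?P. of_nat (?wick p q r s))"
    unfolding norm_Per_power4_eq_sum by (intro has_bochner_integral_sum wick)
  also have "(\<Sum>p\<in>?P. \<Sum>q\<in>?P. \<Sum>r\<in>?P. \<Sum>s\<in>?P. of_nat (?wick p q r s)) =
      complex_of_real (real (Suc k) * (fact k)\<^sup>2)"
    unfolding of_nat_sum[symmetric]
    by (subst sum_permutations_gaussian_mset_moment) (simp_all add: algebra_simps)
  finally have "has_bochner_integral (gauss_matrix k) (\<lambda>X. complex_of_real (cmod (Per k X) ^ 4))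
      (complex_of_real (real (Suc k) * (fact k)\<^sup>2))" .
  from has_bochner_integral_bounded_linear[OF bounded_linear_Re this] show ?thesis
    by (simp only: Re_complex_of_real)
qed

section \<open>Expansion along the first row\<close>

definition row1_expansion :: "nat \<Rightarrow> (cmatrix \<Rightarrow> complex) \<Rightarrow> cmatrix \<Rightarrow> complex" where
  "row1_expansion k g X = (\<Sum>i = 1..k. X (1, i) * g (row1_minor k i X))"

lemma sum_permutes_bij_betw_rows:
  assumes "bij_betw \<theta> S T"
  shows "(\<Sum>\<sigma> | \<sigma> permutes T. \<Prod>x\<in>T. h x (\<sigma> x)) = (\<Sum>\<sigma> | \<sigma> permutes S. \<Prod>x\<in>S. h (\<theta> x) (\<theta> (\<sigma> x)))"
proof -
  have "(\<Sum>\<sigma> | \<sigma> permutes T. \<Prod>x\<in>T. h x (\<sigma> x)) =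
      (\<Sum>\<sigma> | \<sigma> permutes S. \<Prod>x\<in>T. h x (\<theta> (\<sigma> (inv_into S \<theta> x))))"
    by (subst sum.reindex_bij_betw[OF bij_betw_permutations[OF assms], symmetric]) simp
  also have "\<dots> = (\<Sum>\<sigma> | \<sigma> permutes S. \<Prod>x\<in>S. h (\<theta> x) (\<theta> (\<sigma> x)))"
    using bij_betw_inv_into_left[OF assms]
    by (subst prod.reindex_bij_betw[OF assms, symmetric]) simp
  finally show ?thesis .
qed

lemma sum_permutes_bij_betw_columns:
  assumes u: "bij_betw u S C" and v: "bij_betw v S C"
  shows "(\<Sum>\<sigma> | \<sigma> permutes S. \<Prod>x\<in>S. h x (u (\<sigma> x))) = (\<Sum>\<sigma> | \<sigma> permutes S. \<Prod>x\<in>S. h x (v (\<sigma> x)))"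
proof -
  define \<rho> where "\<rho> x = (if x \<in> S then inv_into S v (u x) else x)" for x
  have "bij_betw \<rho> S S"
    using bij_betw_trans[OF u bij_betw_inv_into[OF v]]
    by (rule bij_betw_cong[THEN iffD1, rotated]) (simp add: \<rho>_def)
  then have "\<rho> permutes S" by (rule bij_imp_permutes) (simp add: \<rho>_def)
  have v_\<rho>: "v (\<rho> x) = u x" if "x \<in> S" for x
    using that bij_betw_inv_into_right[OF v, of "u x"] bij_betwE[OF u] by (simp add: \<rho>_def)
  have "(\<Prod>x\<in>S. h x (u (\<sigma> x))) = (\<Prod>x\<in>S. h x (v ((\<rho> \<circ> \<sigma>) x)))" if "\<sigma> permutes S" for \<sigma>
    using permutes_in_image[OF that] by (intro prod.cong refl) (simp add: v_\<rho>)
  then have "(\<Sum>\<sigma> | \<sigma> permutes S. \<Prod>x\<in>S. h x (u (\<sigma> x))) =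
      (\<Sum>\<sigma> | \<sigma> permutes S. \<Prod>x\<in>S. h x (v ((\<rho> \<circ> \<sigma>) x)))"
    by simp
  also have "\<dots> = (\<Sum>\<sigma> | \<sigma> permutes S. \<Prod>x\<in>S. h x (v (\<sigma> x)))"
    by (rule setum_permutations_compose_left[OF \<open>\<rho> permutes S\<close>, symmetric])
  finally show ?thesis .
qed

text \<open>
  Inserting the first row into a permutation enumerates the columns other than \<open>b\<close> by a transposition,
  whereas the minor keeps them in increasing order.
\<close>

lemma sum_permutes_minor_columns:
  assumes b: "b \<in> {1..Suc m}"
  shows "(\<Sum>\<sigma> | \<sigma> permutes {2..Suc m}. \<Prod>x = 2..Suc m. h x (Transposition.transpose 1 b (\<sigma> x))) =
    (\<Sum>\<sigma> | \<sigma> permutes {1..m}. \<Prod>x = 1..m. h (Suc x) (if \<sigma> x < b then \<sigma> x else Suc (\<sigma> x)))"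
proof -
  have "bij_betw Suc {1..m} {2..Suc m}"
    by (rule bij_betw_byWitness[where f' = "\<lambda>x. x - 1"]) auto
  then have "(\<Sum>\<sigma> | \<sigma> permutes {2..Suc m}. \<Prod>x = 2..Suc m. h x (Transposition.transpose 1 b (\<sigma> x))) =
      (\<Sum>\<sigma> | \<sigma> permutes {1..m}. \<Prod>x = 1..m. h (Suc x) (Transposition.transpose 1 b (Suc (\<sigma> x))))"
    by (rule sum_permutes_bij_betw_rows)
  also have "\<dots> = (\<Sum>\<sigma> | \<sigma> permutes {1..m}. \<Prod>x = 1..m. h (Suc x) (if \<sigma> x < b then \<sigma> x else Suc (\<sigma> x)))"
  proof (rule sum_permutes_bij_betw_columns)
    show "bij_betw (\<lambda>x. Transposition.transpose 1 b (Suc x)) {1..m} ({1..Suc m} - {b})"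
      using b by (intro bij_betw_byWitness[where f' = "\<lambda>y. Transposition.transpose 1 b y - 1"])
        (auto simp: Transposition.transpose_def split: if_splits)
    show "bij_betw (\<lambda>x. if x < b then x else Suc x) {1..m} ({1..Suc m} - {b})"
      using b by (intro bij_betw_byWitness[where f' = "\<lambda>y. if y < b then y else y - 1"]) auto
  qed
  finally show ?thesis .
qed

lemma sum_permutes_minor_eq_Per:
  assumes b: "b \<in> {1..Suc m}"
  shows "(\<Sum>\<sigma> | \<sigma> permutes {2..Suc m}. \<Prod>x = 2..Suc m. X (x, Transposition.transpose 1 b (\<sigma> x))) =
    Per m (row1_minor (Suc m) b X)"
proof -
  have "X (Suc x, if \<sigma> x < b then \<sigma> x else Suc (\<sigma> x)) = row1_minor (Suc m) b X (x, \<sigma> x)"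
    if "\<sigma> permutes {1..m}" "x \<in> {1..m}" for \<sigma> x
  proof -
    have "\<sigma> x \<in> {1..m}" using permutes_in_image[of \<sigma> "{1..m}" x] that by blast
    with that(2) show ?thesis by (simp add: row1_minor_def)
  qed
  then show ?thesis
    unfolding sum_permutes_minor_columns[OF b, of "\<lambda>x y. X (x, y)"] Per_def
    by (intro sum.cong prod.cong refl) simp
qed

lemma Per_Suc: "Per (Suc m) X = row1_expansion (Suc m) (Per m) X"
proof -
  let ?col = "\<lambda>b. Transposition.transpose 1 b"
  have rows: "{1..Suc m} = insert 1 {2..Suc m}" by auto
  have "Per (Suc m) X =
      (\<Sum>b = 1..Suc m. \<Sum>\<sigma> | \<sigma> permutes {2..Suc m}. \<Prod>x = 1..Suc m. X (x, ?col b (\<sigma> x)))"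
    using sum_over_permutations_insert[of "{2..Suc m}" 1 "\<lambda>\<sigma>. \<Prod>x = 1..Suc m. X (x, \<sigma> x)"]
    unfolding Per_def rows[symmetric] o_apply by simp
  also have "\<dots> = (\<Sum>b = 1..Suc m.
      X (1, b) * (\<Sum>\<sigma> | \<sigma> permutes {2..Suc m}. \<Prod>x = 2..Suc m. X (x, ?col b (\<sigma> x))))"
  proof -
    have "(\<Prod>x = 1..Suc m. X (x, ?col b (\<sigma> x))) = X (1, b) * (\<Prod>x = 2..Suc m. X (x, ?col b (\<sigma> x)))"
      if "\<sigma> permutes {2..Suc m}" for b \<sigma>
      unfolding rows using permutes_not_in[OF that, of 1] by simp
    then show ?thesis by (simp add: sum_distrib_left)
  qed
  also have "\<dots> = row1_expansion (Suc m) (Per m) X"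
    unfolding row1_expansion_def by (intro sum.cong refl) (simp only: sum_permutes_minor_eq_Per)
  finally show ?thesis .
qed

lemma measurable_gauss_matrix_entry:
  assumes "x \<in> {1..k} \<times> {1..k}"
  shows "(\<lambda>X. X x) \<in> borel_measurable (gauss_matrix k)"
proof -
  have "(\<lambda>X. X x) \<in> gauss_matrix k \<rightarrow>\<^sub>M complex_gaussian"
    using assms unfolding gauss_matrix_def by (rule measurable_component_singleton)
  then show ?thesis by (simp cong: measurable_cong_sets add: sets_complex_gaussian)
qed

lemma measurable_Per [measurable]: "Per k \<in> borel_measurable (gauss_matrix k)"
proof -
  have "(i, \<pi> i) \<in> {1..k} \<times> {1..k}" if "\<pi> permutes {1..k}" "i \<in> {1..k}" for \<pi> i
    using that permutes_in_image[OF that(1), of i] by auto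
  then show ?thesis
    unfolding Per_def[abs_def]
    by (intro borel_measurable_sum borel_measurable_prod measurable_gauss_matrix_entry) auto
qed

lemma
  assumes i: "i \<in> {1..Suc m}" and K: "{2..Suc m} \<times> {1..Suc m} \<subseteq> K"
  shows measurable_row1_minor_PiM:
      "row1_minor (Suc m) i \<in> (\<Pi>\<^sub>M x\<in>K. complex_gaussian) \<rightarrow>\<^sub>M gauss_matrix m"
    and distr_row1_minor_PiM:
      "distr (\<Pi>\<^sub>M x\<in>K. complex_gaussian) (gauss_matrix m) (row1_minor (Suc m) i) = gauss_matrix m"
proof -
  let ?f = "\<lambda>(a, b). (Suc a, if b < i then b else Suc b)"
  let ?I = "{1..m} \<times> {1..m}"
  have f: "?f \<in> ?I \<rightarrow> K" using K i by (force simp: subset_eq)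
  have minor: "row1_minor (Suc m) i = (\<lambda>X. \<lambda>x\<in>?I. X (?f x))"
    by (auto simp: row1_minor_def fun_eq_iff)
  show "row1_minor (Suc m) i \<in> (\<Pi>\<^sub>M x\<in>K. complex_gaussian) \<rightarrow>\<^sub>M gauss_matrix m"
    unfolding minor gauss_matrix_def
    by (intro measurable_restrict measurable_component_singleton funcset_mem[OF f])
  show "distr (\<Pi>\<^sub>M x\<in>K. complex_gaussian) (gauss_matrix m) (row1_minor (Suc m) i) = gauss_matrix m"
    unfolding minor gauss_matrix_def
    by (rule distr_PiM_reindex[OF prob_space_complex_gaussian _ f])
      (auto simp: inj_on_def split: if_splits)
qed

lemma nn_integral_row1_minor_PiM:
  assumes "i \<in> {1..Suc m}" "{2..Suc m} \<times> {1..Suc m} \<subseteq> K" "h \<in> borel_measurable (gauss_matrix m)"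
  shows "(\<integral>\<^sup>+X. h (row1_minor (Suc m) i X) \<partial>(\<Pi>\<^sub>M x\<in>K. complex_gaussian)) =
    (\<integral>\<^sup>+Y. h Y \<partial>gauss_matrix m)"
  using nn_integral_distr[OF measurable_row1_minor_PiM[OF assms(1,2)], of h] assms(3)
  by (simp add: distr_row1_minor_PiM[OF assms(1,2)])

lemma
  assumes "i \<in> {1..Suc m}"
  shows measurable_row1_minor: "row1_minor (Suc m) i \<in> gauss_matrix (Suc m) \<rightarrow>\<^sub>M gauss_matrix m"
    and nn_integral_row1_minor: "h \<in> borel_measurable (gauss_matrix m) \<Longrightarrow>
      (\<integral>\<^sup>+X. h (row1_minor (Suc m) i X) \<partial>gauss_matrix (Suc m)) = (\<integral>\<^sup>+Y. h Y \<partial>gauss_matrix m)"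
proof -
  have "{2..Suc m} \<times> {1..Suc m} \<subseteq> {1..Suc m} \<times> {1..Suc m}" by auto
  from measurable_row1_minor_PiM[OF assms this] nn_integral_row1_minor_PiM[OF assms this]
  show "row1_minor (Suc m) i \<in> gauss_matrix (Suc m) \<rightarrow>\<^sub>M gauss_matrix m"
    "h \<in> borel_measurable (gauss_matrix m) \<Longrightarrow>
      (\<integral>\<^sup>+X. h (row1_minor (Suc m) i X) \<partial>gauss_matrix (Suc m)) = (\<integral>\<^sup>+Y. h Y \<partial>gauss_matrix m)"
    by (simp_all add: gauss_matrix_def[of "Suc m"])
qed

lemma measurable_row1_expansion [measurable]:
  assumes "g \<in> borel_measurable (gauss_matrix m)"
  shows "row1_expansion (Suc m) g \<in> borel_measurable (gauss_matrix (Suc m))"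
  unfolding row1_expansion_def[abs_def]
  by (intro borel_measurable_sum borel_measurable_times measurable_gauss_matrix_entry
      measurable_compose[OF measurable_row1_minor assms]) auto

lemma row1_expansion_merge:
  fixes m :: nat
  defines "I \<equiv> {2..Suc m} \<times> {1..Suc m}" and "J \<equiv> {1} \<times> {1..Suc m}"
  shows "row1_expansion (Suc m) g (merge I J (x, y)) =
    (\<Sum>j\<in>J. y j * g (row1_minor (Suc m) (snd j) x))"
proof -
  have "row1_minor (Suc m) i (merge I J (x, y)) = row1_minor (Suc m) i x"
    and "merge I J (x, y) (1, i) = y (1, i)" if "i \<in> {1..Suc m}" for i
    using that by (auto simp: row1_minor_def fun_eq_iff merge_def I_def J_def)
  then show ?thesis
    unfolding row1_expansion_def
    by (intro sum.reindex_bij_witness[of _ snd "Pair 1"]) (auto simp: J_def)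
qed

text \<open>The first row is independent of the minors along it, and its entries are orthonormal.\<close>

lemma nn_integral_norm_row1_expansion_power2:
  assumes g [measurable]: "g \<in> borel_measurable (gauss_matrix m)"
  shows "(\<integral>\<^sup>+X. ennreal ((cmod (row1_expansion (Suc m) g X))\<^sup>2) \<partial>gauss_matrix (Suc m)) =
    of_nat (Suc m) * (\<integral>\<^sup>+Y. ennreal ((cmod (g Y))\<^sup>2) \<partial>gauss_matrix m)"
proof -
  interpret prob_space complex_gaussian by (rule prob_space_complex_gaussian)
  interpret product_sigma_finite "\<lambda>_::nat \<times> nat. complex_gaussian" by standard
  define I J :: "(nat \<times> nat) set" where "I = {2..Suc m} \<times> {1..Suc m}" and "J = {1} \<times> {1..Suc m}"
  let ?G = "\<lambda>K. \<Pi>\<^sub>M x\<in>K. complex_gaussian"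
  let ?F = "\<lambda>X. ennreal ((cmod (row1_expansion (Suc m) g X))\<^sup>2)"
  let ?g = "\<lambda>i x. ennreal ((cmod (g (row1_minor (Suc m) i x)))\<^sup>2)"
  have measurable_F: "?F \<in> borel_measurable (gauss_matrix (Suc m))" by measurable
  have index_set: "{1..Suc m} \<times> {1..Suc m} = I \<union> J" by (auto simp: I_def J_def)
  have measurable_norm_g: "(\<lambda>Y. ennreal ((cmod (g Y))\<^sup>2)) \<in> borel_measurable (gauss_matrix m)" by measurable
  have "(\<integral>\<^sup>+X. ?F X \<partial>gauss_matrix (Suc m)) = (\<integral>\<^sup>+x. (\<integral>\<^sup>+y. ?F (merge I J (x, y)) \<partial>?G J) \<partial>?G I)"
    using measurable_F unfolding gauss_matrix_def index_set
    by (intro product_nn_integral_fold) (auto simp: I_def J_def)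
  also have "\<dots> = (\<integral>\<^sup>+x. (\<Sum>j\<in>J. ?g (snd j) x) \<partial>?G I)"
  proof (rule nn_integral_cong)
    fix x
    have "has_bochner_integral (?G J) (\<lambda>y. (cmod (row1_expansion (Suc m) g (merge I J (x, y))))\<^sup>2)
        (\<Sum>j\<in>J. (cmod (g (row1_minor (Suc m) (snd j) x)))\<^sup>2)"
      unfolding row1_expansion_merge I_def J_def
      by (intro has_bochner_integral_gaussian_linear_form) auto
    then show "(\<integral>\<^sup>+y. ?F (merge I J (x, y)) \<partial>?G J) = (\<Sum>j\<in>J. ?g (snd j) x)"
      by (subst nn_integral_eq_integral) (auto simp: has_bochner_integral_iff sum_ennreal)
  qed
  also have "\<dots> = (\<Sum>j\<in>J. \<integral>\<^sup>+x. ?g (snd j) x \<partial>?G I)"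
    by (intro nn_integral_sum measurable_compose[OF measurable_row1_minor_PiM measurable_norm_g])
      (auto simp: I_def J_def)
  also have "\<dots> = (\<Sum>j\<in>J. \<integral>\<^sup>+Y. ennreal ((cmod (g Y))\<^sup>2) \<partial>gauss_matrix m)"
    by (intro sum.cong refl nn_integral_row1_minor_PiM measurable_norm_g) (auto simp: I_def J_def)
  finally show ?thesis by (simp add: J_def)
qed

section \<open>Propagation of the error\<close>

text \<open>
  Minkowski's inequality in \<open>L\<^sup>2\<close>: the weights \<open>(a + b) / a\<close> and \<open>(a + b) / b\<close> integrate to exactly
  \<open>(a + b)\<^sup>2\<close>.
\<close>

lemma nn_integral_power2_add_le:
  fixes f g :: "'a \<Rightarrow> real"
  assumes [measurable]: "f \<in> borel_measurable M" "g \<in> borel_measurable M"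
    and pos: "0 < a" "0 < b"
    and f_le: "(\<integral>\<^sup>+x. ennreal ((f x)\<^sup>2) \<partial>M) \<le> ennreal (a\<^sup>2)"
    and g_le: "(\<integral>\<^sup>+x. ennreal ((g x)\<^sup>2) \<partial>M) \<le> ennreal (b\<^sup>2)"
  shows "(\<integral>\<^sup>+x. ennreal ((f x + g x)\<^sup>2) \<partial>M) \<le> ennreal ((a + b)\<^sup>2)"
proof -
  have weighted: "(x + y)\<^sup>2 \<le> (a + b) / a * x\<^sup>2 + (a + b) / b * y\<^sup>2" for x y :: real
  proof -
    have "(a + b) / a * x\<^sup>2 + (a + b) / b * y\<^sup>2 - (x + y)\<^sup>2 = (b * x - a * y)\<^sup>2 / (a * b)"
      using pos by (simp add: field_simps power2_eq_square)
    also have "\<dots> \<ge> 0" using pos by simp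
    finally show ?thesis by simp
  qed
  have "(\<integral>\<^sup>+x. ennreal ((f x + g x)\<^sup>2) \<partial>M) \<le>
      (\<integral>\<^sup>+x. ennreal ((a + b) / a) * ennreal ((f x)\<^sup>2) +
        ennreal ((a + b) / b) * ennreal ((g x)\<^sup>2) \<partial>M)"
    using pos weighted by (intro nn_integral_mono) (simp flip: ennreal_mult ennreal_plus)
  also have "\<dots> = ennreal ((a + b) / a) * (\<integral>\<^sup>+x. ennreal ((f x)\<^sup>2) \<partial>M) +
      ennreal ((a + b) / b) * (\<integral>\<^sup>+x. ennreal ((g x)\<^sup>2) \<partial>M)"
    by (simp add: nn_integral_add nn_integral_cmult)
  also have "\<dots> \<le> ennreal ((a + b) / a) * ennreal (a\<^sup>2) + ennreal ((a + b) / b) * ennreal (b\<^sup>2)"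
    by (intro add_mono mult_left_mono f_le g_le) auto
  also have "\<dots> = ennreal ((a + b) / a * a\<^sup>2 + (a + b) / b * b\<^sup>2)"
    using pos by (simp flip: ennreal_mult ennreal_plus)
  also have "(a + b) / a * a\<^sup>2 + (a + b) / b * b\<^sup>2 = (a + b)\<^sup>2"
    using pos by (simp add: field_simps power2_eq_square)
  finally show ?thesis .
qed

definition bad_minors :: "nat \<Rightarrow> (cmatrix \<Rightarrow> bool) \<Rightarrow> cmatrix \<Rightarrow> real" where
  "bad_minors k G X = (\<Sum>i = 1..k. of_bool (\<not> G (row1_minor k i X)))"

lemma bad_minors_nonneg: "0 \<le> bad_minors k G X"
  by (simp add: bad_minors_def sum_nonneg)

lemma bad_minors_ge_1:
  assumes "i \<in> {1..k}" "\<not> G (row1_minor k i X)"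
  shows "1 \<le> bad_minors k G X"
  using assms member_le_sum[of i "{1..k}" "\<lambda>i. of_bool (\<not> G (row1_minor k i X)) :: real"]
  by (simp add: bad_minors_def)

lemma
  assumes G [measurable]: "Measurable.pred (gauss_matrix m) G"
  shows measurable_bad_minors:
      "bad_minors (Suc m) G \<in> borel_measurable (gauss_matrix (Suc m))"
    and nn_integral_bad_minors: "(\<integral>\<^sup>+X. ennreal (bad_minors (Suc m) G X) \<partial>gauss_matrix (Suc m)) =
      ennreal (real (Suc m) * measure (gauss_matrix m) {Y \<in> space (gauss_matrix m). \<not> G Y})"
proof -
  interpret prob_space "gauss_matrix m" by (rule prob_space_gauss_matrix)
  have not_G: "(\<lambda>Y. of_bool (\<not> G Y) :: real) \<in> borel_measurable (gauss_matrix m)"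
    and ennreal_not_G: "(\<lambda>Y. ennreal (of_bool (\<not> G Y))) \<in> borel_measurable (gauss_matrix m)"
    by measurable
  note minor = measurable_compose[OF measurable_row1_minor]
  show "bad_minors (Suc m) G \<in> borel_measurable (gauss_matrix (Suc m))"
    unfolding bad_minors_def[abs_def] by (intro borel_measurable_sum minor[OF _ not_G])
  have "(\<integral>\<^sup>+X. ennreal (bad_minors (Suc m) G X) \<partial>gauss_matrix (Suc m)) =
      (\<Sum>i = 1..Suc m. \<integral>\<^sup>+X. ennreal (of_bool (\<not> G (row1_minor (Suc m) i X))) \<partial>gauss_matrix (Suc m))"
    unfolding bad_minors_def
    by (subst sum_ennreal[symmetric], simp) (intro nn_integral_sum minor[OF _ ennreal_not_G])
  also have "\<dots> = (\<Sum>i = 1..Suc m. \<integral>\<^sup>+Y. ennreal (of_bool (\<not> G Y)) \<partial>gauss_matrix m)"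
    by (intro sum.cong refl nn_integral_row1_minor ennreal_not_G)
  also have "(\<integral>\<^sup>+Y. ennreal (of_bool (\<not> G Y)) \<partial>gauss_matrix m) =
      (\<integral>\<^sup>+Y. indicator {Y \<in> space (gauss_matrix m). \<not> G Y} Y \<partial>gauss_matrix m)"
    by (intro nn_integral_cong) (auto simp: indicator_def)
  finally show "(\<integral>\<^sup>+X. ennreal (bad_minors (Suc m) G X) \<partial>gauss_matrix (Suc m)) =
      ennreal (real (Suc m) * prob {Y \<in> space (gauss_matrix m). \<not> G Y})"
    by (subst ennreal_mult) (simp_all add: emeasure_eq_measure ennreal_of_nat_eq_real_of_nat)
qed

lemma error_le_row1_expansion:
  fixes f :: "cmatrix \<Rightarrow> complex" and G :: "cmatrix \<Rightarrow> bool" and m :: nat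
  defines "e \<equiv> \<lambda>Y. of_bool (G Y) * (f Y - Per m Y)"
  assumes lin: "(cmod (w - row1_expansion (Suc m) f X))\<^sup>2 \<le> r\<^sup>2" "0 \<le> r"
    and tail: "(cmod (w - Per (Suc m) X))\<^sup>2 \<le> t"
  shows "(cmod (w - Per (Suc m) X))\<^sup>2 \<le>
    (r + cmod (row1_expansion (Suc m) e X))\<^sup>2 + t * bad_minors (Suc m) G X"
proof (cases "\<forall>i\<in>{1..Suc m}. G (row1_minor (Suc m) i X)")
  case True
  then have "row1_expansion (Suc m) e X = row1_expansion (Suc m) f X - Per (Suc m) X"
    unfolding Per_Suc row1_expansion_def sum_subtractf[symmetric]
    by (intro sum.cong refl) (simp add: e_def right_diff_distrib)
  then have "w - Per (Suc m) X = (w - row1_expansion (Suc m) f X) + row1_expansion (Suc m) e X"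
    by simp
  moreover have "cmod (w - row1_expansion (Suc m) f X) \<le> r"
    using lin by (rule power2_le_imp_le)
  ultimately have "cmod (w - Per (Suc m) X) \<le> r + cmod (row1_expansion (Suc m) e X)"
    by (metis add_right_mono norm_triangle_ineq order_trans)
  then have "(cmod (w - Per (Suc m) X))\<^sup>2 \<le> (r + cmod (row1_expansion (Suc m) e X))\<^sup>2"
    by (rule power_mono) simp
  moreover have "0 \<le> t * bad_minors (Suc m) G X"
    using order_trans[OF zero_le_power2 tail] bad_minors_nonneg by (rule mult_nonneg_nonneg)
  ultimately show ?thesis by simp
next
  case False
  then have "1 \<le> bad_minors (Suc m) G X" by (auto intro: bad_minors_ge_1)
  moreover have "0 \<le> t" by (rule order_trans[OF zero_le_power2 tail])
  ultimately have "t \<le> t * bad_minors (Suc m) G X" by (simp add: mult_le_cancel_left1)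
  with tail show ?thesis
    using zero_le_power2[of "r + cmod (row1_expansion (Suc m) e X)"] by linarith
qed

lemma nn_integral_norm_row1_expansion_power2_le:
  assumes "g \<in> borel_measurable (gauss_matrix m)"
    and "(\<integral>\<^sup>+Y. ennreal ((cmod (g Y))\<^sup>2) \<partial>gauss_matrix m) \<le> ennreal (v * fact m)" "0 \<le> v"
  shows "(\<integral>\<^sup>+X. ennreal ((cmod (row1_expansion (Suc m) g X))\<^sup>2) \<partial>gauss_matrix (Suc m)) \<le>
    ennreal (v * fact (Suc m))"
proof -
  have "of_nat (Suc m) * (\<integral>\<^sup>+Y. ennreal ((cmod (g Y))\<^sup>2) \<partial>gauss_matrix m) \<le>
      of_nat (Suc m) * ennreal (v * fact m)"
    using assms(2) by (rule mult_left_mono) simp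
  also have "\<dots> = ennreal (real (Suc m) * (v * fact m))"
    using assms(3) by (subst ennreal_mult) (simp_all add: ennreal_of_nat_eq_real_of_nat)
  finally show ?thesis
    unfolding nn_integral_norm_row1_expansion_power2[OF assms(1)] by (simp add: algebra_simps)
qed

lemma nn_integral_add_norm_row1_expansion_power2_le:
  assumes [measurable]: "g \<in> borel_measurable (gauss_matrix m)"
    and g_le: "(\<integral>\<^sup>+Y. ennreal ((cmod (g Y))\<^sup>2) \<partial>gauss_matrix m) \<le> ennreal (b\<^sup>2 * fact m)"
    and pos: "0 < a" "0 < b"
  shows "(\<integral>\<^sup>+X. ennreal ((a * sqrt (fact (Suc m)) + cmod (row1_expansion (Suc m) g X))\<^sup>2)
      \<partial>gauss_matrix (Suc m)) \<le> ennreal ((a + b)\<^sup>2 * fact (Suc m))"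
proof -
  interpret prob_space "gauss_matrix (Suc m)" by (rule prob_space_gauss_matrix)
  define \<phi> :: real where "\<phi> = sqrt (fact (Suc m))"
  have \<phi>: "0 < \<phi>" "\<phi>\<^sup>2 = fact (Suc m)" by (simp_all add: \<phi>_def del: fact_Suc)
  have "(\<integral>\<^sup>+X. ennreal ((cmod (row1_expansion (Suc m) g X))\<^sup>2) \<partial>gauss_matrix (Suc m)) \<le>
      ennreal ((b * \<phi>)\<^sup>2)"
    using nn_integral_norm_row1_expansion_power2_le[OF assms(1) g_le]
    by (simp add: power_mult_distrib \<phi>(2) del: fact_Suc)
  then have "(\<integral>\<^sup>+X. ennreal ((a * \<phi> + cmod (row1_expansion (Suc m) g X))\<^sup>2) \<partial>gauss_matrix (Suc m)) \<le>
      ennreal ((a * \<phi> + b * \<phi>)\<^sup>2)"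
    using pos \<phi> by (intro nn_integral_power2_add_le) (simp_all add: emeasure_space_1)
  also have "(a * \<phi> + b * \<phi>)\<^sup>2 = (a + b)\<^sup>2 * fact (Suc m)"
    by (simp add: \<phi>(2)[symmetric] power_mult_distrib[symmetric] distrib_right del: fact_Suc)
  finally show ?thesis by (simp only: \<phi>_def)
qed

lemma nn_integral_error_le:
  fixes a b \<epsilon> t :: real
  assumes [measurable]: "f \<in> borel_measurable (gauss_matrix m)"
    and G [measurable]: "Measurable.pred (gauss_matrix m) G"
    and pos: "0 < a" "0 < b" "0 \<le> t"
    and lin: "\<And>X. H X \<Longrightarrow> (cmod (f' X - row1_expansion (Suc m) f X))\<^sup>2 \<le> a\<^sup>2 * fact (Suc m)"
    and tail: "\<And>X. H X \<Longrightarrow> (cmod (f' X - Per (Suc m) X))\<^sup>2 \<le> t * fact (Suc m)"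
    and prob: "measure (gauss_matrix m) {Y \<in> space (gauss_matrix m). \<not> G Y} \<le> \<epsilon>"
    and err: "(\<integral>\<^sup>+Y. ennreal (of_bool (G Y) * (cmod (f Y - Per m Y))\<^sup>2) \<partial>gauss_matrix m) \<le>
      ennreal (b\<^sup>2 * fact m)"
  shows "(\<integral>\<^sup>+X. ennreal (of_bool (H X) * (cmod (f' X - Per (Suc m) X))\<^sup>2) \<partial>gauss_matrix (Suc m)) \<le>
    ennreal (((a + b)\<^sup>2 + real (Suc m) * \<epsilon> * t) * fact (Suc m))"
proof -
  let ?M = "gauss_matrix (Suc m)" and ?B = "bad_minors (Suc m) G" and ?F = "fact (Suc m) :: real"
  define e where "e Y = of_bool (G Y) * (f Y - Per m Y)" for Y
  define E where "E X = (a * sqrt ?F + cmod (row1_expansion (Suc m) e X))\<^sup>2" for X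
  have [measurable]: "e \<in> borel_measurable (gauss_matrix m)" unfolding e_def by measurable
  have [measurable]: "E \<in> borel_measurable ?M" unfolding E_def by measurable
  note [measurable] = measurable_bad_minors
  have "(cmod (e Y))\<^sup>2 = of_bool (G Y) * (cmod (f Y - Per m Y))\<^sup>2" for Y
    by (simp add: e_def norm_mult)
  then have E_le: "(\<integral>\<^sup>+X. ennreal (E X) \<partial>?M) \<le> ennreal ((a + b)\<^sup>2 * ?F)"
    unfolding E_def using err pos by (intro nn_integral_add_norm_row1_expansion_power2_le) simp_all
  have B_le: "(\<integral>\<^sup>+X. ennreal (?B X) \<partial>?M) \<le> ennreal (real (Suc m) * \<epsilon>)"
    unfolding nn_integral_bad_minors[OF G]
    using prob by (intro ennreal_leI mult_left_mono) simp_all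
  have pointwise: "of_bool (H X) * (cmod (f' X - Per (Suc m) X))\<^sup>2 \<le> E X + t * ?F * ?B X" for X
  proof (cases "H X")
    case True
    have "a\<^sup>2 * ?F = (a * sqrt ?F)\<^sup>2" by (simp add: power_mult_distrib)
    with lin[OF True] tail[OF True] pos True show ?thesis
      unfolding E_def e_def by (simp add: error_le_row1_expansion del: fact_Suc)
  qed (use pos bad_minors_nonneg in \<open>simp add: E_def\<close>)
  have "(\<integral>\<^sup>+X. ennreal (of_bool (H X) * (cmod (f' X - Per (Suc m) X))\<^sup>2) \<partial>?M) \<le>
      (\<integral>\<^sup>+X. ennreal (E X) + ennreal (t * ?F) * ennreal (?B X) \<partial>?M)"
    using pointwise pos bad_minors_nonneg
    by (intro nn_integral_mono) (simp add: E_def del: fact_Suc flip: ennreal_mult ennreal_plus)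
  also have "\<dots> = (\<integral>\<^sup>+X. ennreal (E X) \<partial>?M) + ennreal (t * ?F) * (\<integral>\<^sup>+X. ennreal (?B X) \<partial>?M)"
    by (simp add: nn_integral_add nn_integral_cmult del: fact_Suc)
  also have "\<dots> \<le> ennreal ((a + b)\<^sup>2 * ?F) + ennreal (t * ?F) * ennreal (real (Suc m) * \<epsilon>)"
    using E_le B_le by (intro add_mono mult_left_mono) simp_all
  also have "\<dots> = ennreal ((a + b)\<^sup>2 * ?F + t * ?F * (real (Suc m) * \<epsilon>))"
    using pos order_trans[OF measure_nonneg prob]
    by (simp del: fact_Suc flip: ennreal_mult ennreal_plus)
  finally show ?thesis by (simp add: algebra_simps del: fact_Suc)
qed

section \<open>The test\<close>

lemma (in finite_product_prob_space) prob_PiE_le_exp: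
  assumes "\<And>i. i \<in> I \<Longrightarrow> A i \<in> sets (M i)"
  shows "prob (Pi\<^sub>E I A) \<le> exp (- (\<Sum>i\<in>I. 1 - M.prob i (A i)))"
proof -
  have "prob (Pi\<^sub>E I A) = (\<Prod>i\<in>I. M.prob i (A i))"
    using assms by (rule prob_times)
  also have "\<dots> \<le> (\<Prod>i\<in>I. exp (M.prob i (A i) - 1))"
    using exp_ge_add_one_self[of "M.prob _ (A _) - 1"] by (intro prod_mono) simp
  also have "\<dots> = exp (- (\<Sum>i\<in>I. 1 - M.prob i (A i)))"
    by (simp add: exp_sum[symmetric] finite_index flip: sum_negf)
  finally show ?thesis .
qed

lemma measurable_PERM [measurable]: "Measurable.pred (gauss_matrix k) (PERM t k)"
  unfolding PERM_def[abs_def] by measurable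

lemma prob_not_PERM_le:
  assumes "0 < t"
  shows "measure (gauss_matrix k) {X \<in> space (gauss_matrix k). \<not> PERM t k X} \<le> real (Suc k) / t ^ 4"
proof -
  interpret prob_space "gauss_matrix k" by (rule prob_space_gauss_matrix)
  note moment = has_bochner_integral_norm_Per_power4[of k]
  have pos: "0 < (t\<^sup>2 * fact k)\<^sup>2" using assms by simp
  have "prob {X \<in> space (gauss_matrix k). \<not> PERM t k X} \<le>
      prob {X \<in> space (gauss_matrix k). (t\<^sup>2 * fact k)\<^sup>2 \<le> cmod (Per k X) ^ 4}"
  proof (intro finite_measure_mono subsetI CollectI conjI)
    fix X assume "X \<in> {X \<in> space (gauss_matrix k). \<not> PERM t k X}"
    then have "t\<^sup>2 * fact k \<le> (cmod (Per k X))\<^sup>2" by (simp add: PERM_def)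
    then have "(t\<^sup>2 * fact k)\<^sup>2 \<le> ((cmod (Per k X))\<^sup>2)\<^sup>2" by (rule power_mono) simp
    then show "(t\<^sup>2 * fact k)\<^sup>2 \<le> cmod (Per k X) ^ 4" by (simp flip: power_mult)
  qed auto
  also have "\<dots> \<le> expectation (\<lambda>X. cmod (Per k X) ^ 4) / (t\<^sup>2 * fact k)\<^sup>2"
    using moment pos
    by (intro integral_Markov_inequality_measure[where A = "{}"])
      (auto simp: has_bochner_integral_iff)
  also have "\<dots> = real (Suc k) / t ^ 4"
    unfolding has_bochner_integral_integral_eq[OF moment]
    by (simp add: power_mult_distrib flip: power_mult)
  finally show ?thesis .
qed

lemma norm_diff_Per_le_of_TAIL_PERM:
  assumes "TAIL t \<O> k X" "PERM t k X"
  shows "(cmod (\<O> k X - Per k X))\<^sup>2 \<le> 4 * t\<^sup>2 * fact k"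
proof -
  have "(cmod (\<O> k X - Per k X))\<^sup>2 \<le> (cmod (\<O> k X) + cmod (Per k X))\<^sup>2"
    by (intro power_mono norm_triangle_ineq4) simp
  also have "\<dots> \<le> 2 * (cmod (\<O> k X))\<^sup>2 + 2 * (cmod (Per k X))\<^sup>2"
    using sum_squares_bound[of "cmod (\<O> k X)" "cmod (Per k X)"] by (simp add: power2_sum)
  also have "\<dots> \<le> 4 * t\<^sup>2 * fact k"
    using assms unfolding TAIL_def PERM_def by simp
  finally show ?thesis .
qed

lemma LIN_Suc:
  assumes "0 < m"
  shows "LIN n \<delta> \<O> (Suc m) X \<longleftrightarrow>
    (cmod (\<O> (Suc m) X - row1_expansion (Suc m) (\<O> m) X))\<^sup>2 \<le> (real n * \<delta>)\<^sup>2 * fact (Suc m)"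
  using assms by (simp add: LIN_def row1_expansion_def power_mult_distrib)

locale PTest_oracles =
  fixes n :: nat and \<delta> c :: real and \<O> :: "nat \<Rightarrow> cmatrix \<Rightarrow> complex"
  assumes \<delta>_pos: "0 < \<delta>" and c_pos: "0 < c" and c_le_1: "c \<le> 1"
    and measurable_oracle: "k \<in> {1..n} \<Longrightarrow> \<O> k \<in> borel_measurable (gauss_matrix k)"
begin

abbreviation T :: real where "T \<equiv> T_param n \<delta> c"

abbreviation \<epsilon> :: real where "\<epsilon> \<equiv> \<delta> ^ 4 * c / (64 * real n)"

lemma Suc_div_T_power4_le:
  assumes k: "k \<in> {1..n}"
  shows "real (Suc k) / T ^ 4 \<le> \<epsilon> / 2"
proof -
  have n_ge_1: "1 \<le> real n" using k by simp
  have "sqrt c ^ 4 = c\<^sup>2"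
    using c_pos power_mult[of "sqrt c" 2 2] by simp
  then have T_power4: "T ^ 4 = 256 * real n ^ 4 / (\<delta> ^ 4 * c\<^sup>2)"
    by (simp add: T_param_def power_divide power_mult_distrib)
  have ratio: "c / (real n)\<^sup>2 \<le> 1"
    using order_trans[OF c_le_1 one_le_power[OF n_ge_1, of 2]] n_ge_1 by simp
  have "real (Suc k) / T ^ 4 \<le> (2 * real n) / T ^ 4"
    using k by (intro divide_right_mono) auto
  also have "\<dots> = \<epsilon> / 2 * (c / (real n)\<^sup>2)"
    unfolding T_power4 using n_ge_1 \<delta>_pos c_pos by (simp add: field_simps eval_nat_numeral)
  also have "\<dots> \<le> \<epsilon> / 2 * 1"
    using ratio by (rule mult_left_mono) (use n_ge_1 c_pos in simp)
  finally show ?thesis by simp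
qed

lemma error_bound_Suc_le:
  assumes "m \<in> {1..n}" "Suc m \<le> n"
  shows "(real n * \<delta> + 2 * real n * real m * \<delta>)\<^sup>2 + real (Suc m) * \<epsilon> * (4 * T\<^sup>2) \<le>
    (2 * real n * real (Suc m) * \<delta>)\<^sup>2"
proof -
  have n_pos: "0 < real n" using assms by simp
  have "\<epsilon> * (4 * T\<^sup>2) = real n * \<delta>\<^sup>2"
    using n_pos \<delta>_pos c_pos
    by (simp add: T_param_def power_divide power_mult_distrib field_simps eval_nat_numeral)
  then have "real (Suc m) * \<epsilon> * (4 * T\<^sup>2) = real (Suc m) * (real n * \<delta>\<^sup>2)"
    by (simp only: mult.assoc)
  also have "\<dots> \<le> real n * (real n * \<delta>\<^sup>2)"
    using assms by (intro mult_right_mono) auto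
  finally have "(real n * \<delta> + 2 * real n * real m * \<delta>)\<^sup>2 + real (Suc m) * \<epsilon> * (4 * T\<^sup>2) \<le>
      (real n * \<delta>)\<^sup>2 * ((2 * real m + 1)\<^sup>2 + 1)"
    by (simp add: power2_eq_square algebra_simps)
  also have "\<dots> \<le> (real n * \<delta>)\<^sup>2 * (2 * real m + 2)\<^sup>2"
    by (rule mult_left_mono[OF _ zero_le_power2]) (simp add: power2_eq_square algebra_simps)
  also have "\<dots> = (2 * real n * real (Suc m) * \<delta>)\<^sup>2"
    by (simp add: power2_eq_square algebra_simps)
  finally show ?thesis .
qed

definition passes :: "test_kind \<Rightarrow> nat \<Rightarrow> cmatrix \<Rightarrow> bool" where
  "passes t = (case t of Linearity \<Rightarrow> LIN n \<delta> \<O> | Tail \<Rightarrow> TAIL T \<O>)"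

definition failure_prob :: "test_kind \<Rightarrow> nat \<Rightarrow> real" where
  "failure_prob t k = measure (gauss_matrix k) {X \<in> space (gauss_matrix k). \<not> passes t k X}"

definition good :: "nat \<Rightarrow> cmatrix \<Rightarrow> bool" where
  "good k X \<longleftrightarrow> passes Linearity k X \<and> passes Tail k X \<and> PERM T k X"

lemma ind_eq_good: "ind n \<delta> c \<O> k X = of_bool (good k X)"
  by (simp add: ind_def good_def passes_def)

lemma measurable_passes:
  assumes "k \<in> {1..n}"
  shows "Measurable.pred (gauss_matrix k) (passes t k)"
proof (cases t)
  case Tail
  then show ?thesis
    using measurable_oracle[OF assms] unfolding passes_def TAIL_def[abs_def] by simp
next
  case Linearity
  obtain m where k: "k = Suc m" using assms by (cases k) auto
  show ?thesis
  proof (cases "m = 0")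
    case True
    then show ?thesis
      using Linearity measurable_oracle[OF assms] measurable_gauss_matrix_entry[of "(1, 1)" 1]
      by (simp add: passes_def LIN_def[abs_def] k)
  next
    case False
    then have "\<O> m \<in> borel_measurable (gauss_matrix m)"
      "\<O> k \<in> borel_measurable (gauss_matrix k)"
      using assms k by (auto intro: measurable_oracle)
    note [measurable] = this[unfolded k]
    have "passes t k = (\<lambda>X. (cmod (\<O> k X - row1_expansion k (\<O> m) X))\<^sup>2 \<le> (real n * \<delta>)\<^sup>2 * fact k)"
      using False Linearity by (simp add: fun_eq_iff passes_def LIN_Suc k)
    also have "Measurable.pred (gauss_matrix k) \<dots>" unfolding k by measurable
    finally show ?thesis .
  qed
qed

lemma measurable_good:
  assumes "k \<in> {1..n}"
  shows "Measurable.pred (gauss_matrix k) (good k)"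
  unfolding good_def[abs_def] using measurable_passes[OF assms] by measurable

definition runs :: "(test_kind \<times> nat \<times> nat) set" where
  "runs = {Linearity, Tail} \<times> {1..n} \<times> {..<num_runs n \<delta> c}"

lemma PTest_eq_Accept_iff:
  "PTest n \<delta> c \<O> \<omega> = Accept \<longleftrightarrow> (\<forall>x\<in>runs. passes (fst x) (fst (snd x)) (\<omega> x))"
  by (auto simp: PTest_def LinearityTest_def TailTest_def passes_def runs_def)

lemma sum_failure_prob_runs:
  "(\<Sum>x\<in>runs. failure_prob (fst x) (fst (snd x))) =
    real (num_runs n \<delta> c) * (\<Sum>k = 1..n. failure_prob Linearity k + failure_prob Tail k)"
proof -
  have "(\<Sum>x\<in>runs. failure_prob (fst x) (fst (snd x))) = (\<Sum>(t, k, j)\<in>runs. failure_prob t k)"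
    by (simp add: case_prod_unfold)
  also have "\<dots> =
      real (num_runs n \<delta> c) * (\<Sum>k = 1..n. failure_prob Linearity k + failure_prob Tail k)"
    unfolding runs_def sum.cartesian_product[symmetric]
    by (simp add: sum.distrib distrib_left sum_distrib_left)
  finally show ?thesis .
qed

lemma
  shows prob_PTest_Accept_le: "\<P>(\<omega> in PTest_samples n \<delta> c. PTest n \<delta> c \<O> \<omega> = Accept) \<le>
      exp (- (real (num_runs n \<delta> c) * (\<Sum>k = 1..n. failure_prob Linearity k + failure_prob Tail k)))"
    and sets_PTest_Accept:
      "{\<omega> \<in> space (PTest_samples n \<delta> c). PTest n \<delta> c \<O> \<omega> = Accept} \<in> sets (PTest_samples n \<delta> c)"
    and prob_space_PTest_samples: "prob_space (PTest_samples n \<delta> c)"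
proof -
  define M where "M x = gauss_matrix (fst (snd x))" for x :: "test_kind \<times> nat \<times> nat"
  define A where "A x = {X \<in> space (M x). passes (fst x) (fst (snd x)) X}" for x
  have "finite runs" by (simp add: runs_def)
  interpret product_prob_space M runs
    by (intro product_prob_spaceI) (simp add: M_def prob_space_gauss_matrix)
  interpret finite_product_prob_space M runs
    by unfold_locales (rule \<open>finite runs\<close>)
  have samples: "PTest_samples n \<delta> c = PiM runs M"
    by (simp add: PTest_samples_def runs_def M_def[abs_def] case_prod_unfold)
  show "prob_space (PTest_samples n \<delta> c)" unfolding samples by (rule prob_space_axioms)
  have passes: "Measurable.pred (M x) (passes (fst x) (fst (snd x)))" if "x \<in> runs" for x
    unfolding M_def using that by (intro measurable_passes) (auto simp: runs_def)
  then have sets_A: "A x \<in> sets (M x)" if "x \<in> runs" for x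
    using that by (simp add: A_def pred_def)
  have accept: "{\<omega> \<in> space (PTest_samples n \<delta> c). PTest n \<delta> c \<O> \<omega> = Accept} = Pi\<^sub>E runs A"
    by (rule set_eqI) (simp add: PTest_eq_Accept_iff samples space_PiM A_def PiE_iff, blast)
  show "{\<omega> \<in> space (PTest_samples n \<delta> c). PTest n \<delta> c \<O> \<omega> = Accept} \<in> sets (PTest_samples n \<delta> c)"
    unfolding accept using sets_A \<open>finite runs\<close> by (simp add: samples sets_PiM_I_finite)
  have "1 - M.prob x (A x) = failure_prob (fst x) (fst (snd x))" if "x \<in> runs" for x
    using M.prob_neg[of x "passes (fst x) (fst (snd x))"] sets_A[OF that]
    by (simp add: A_def failure_prob_def M_def)
  then show "\<P>(\<omega> in PTest_samples n \<delta> c. PTest n \<delta> c \<O> \<omega> = Accept) \<le>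
      exp (- (real (num_runs n \<delta> c) * (\<Sum>k = 1..n. failure_prob Linearity k + failure_prob Tail k)))"
    using prob_PiE_le_exp[OF sets_A] unfolding accept sum_failure_prob_runs[symmetric]
    by (simp add: samples)
qed

end

locale PTest_rarely_rejecting = PTest_oracles +
  assumes prob_PTest_Reject_less:
    "\<P>(\<omega> in PTest_samples n \<delta> c. PTest n \<delta> c \<O> \<omega> = Reject) < 1 - exp (- real n)"
begin

lemma sum_failure_prob_less:
  "real (num_runs n \<delta> c) * (\<Sum>k = 1..n. failure_prob Linearity k + failure_prob Tail k) < real n"
proof -
  interpret prob_space "PTest_samples n \<delta> c" by (rule prob_space_PTest_samples)
  have "v = Reject \<longleftrightarrow> v \<noteq> Accept" for v by (cases v) simp_all
  then have "\<P>(\<omega> in PTest_samples n \<delta> c. PTest n \<delta> c \<O> \<omega> = Reject) =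
      1 - \<P>(\<omega> in PTest_samples n \<delta> c. PTest n \<delta> c \<O> \<omega> = Accept)"
    using prob_neg[OF sets_PTest_Accept] by simp
  then have "exp (- real n) < \<P>(\<omega> in PTest_samples n \<delta> c. PTest n \<delta> c \<O> \<omega> = Accept)"
    using prob_PTest_Reject_less by simp
  from less_le_trans[OF this prob_PTest_Accept_le] show ?thesis by simp
qed

lemma failure_prob_le:
  assumes k: "k \<in> {1..n}"
  shows "failure_prob Linearity k + failure_prob Tail k \<le> \<epsilon> / 3"
proof -
  have n_pos: "0 < real n" using k by simp
  have num_runs_ge: "0 < d_param n \<delta> c" "d_param n \<delta> c \<le> real (num_runs n \<delta> c)"
    using n_pos \<delta>_pos c_pos by (auto simp: d_param_def num_runs_def of_nat_ceiling)
  have nonneg: "0 \<le> failure_prob t k" for t k by (simp add: failure_prob_def)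
  then have "failure_prob Linearity k + failure_prob Tail k \<le>
      (\<Sum>k = 1..n. failure_prob Linearity k + failure_prob Tail k)"
    using k by (intro member_le_sum) auto
  then have "d_param n \<delta> c * (failure_prob Linearity k + failure_prob Tail k) \<le>
      real (num_runs n \<delta> c) * (\<Sum>k = 1..n. failure_prob Linearity k + failure_prob Tail k)"
    using num_runs_ge nonneg by (intro mult_mono) auto
  with sum_failure_prob_less
  have "d_param n \<delta> c * (failure_prob Linearity k + failure_prob Tail k) \<le> real n"
    by simp
  then have "failure_prob Linearity k + failure_prob Tail k \<le> real n / d_param n \<delta> c"
    using num_runs_ge by (simp add: field_simps)
  also have "\<dots> = \<epsilon> / 3"
    using n_pos \<delta>_pos c_pos by (simp add: d_param_def field_simps power2_eq_square)
  finally show ?thesis .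
qed

lemma prob_not_good_le:
  assumes k: "k \<in> {1..n}"
  shows "measure (gauss_matrix k) {X \<in> space (gauss_matrix k). \<not> good k X} \<le> \<epsilon>"
proof -
  interpret prob_space "gauss_matrix k" by (rule prob_space_gauss_matrix)
  have n_ge_1: "1 \<le> real n" using k by simp
  have T_pos: "0 < T" using n_ge_1 \<delta>_pos c_pos by (simp add: T_param_def)
  let ?N = "\<lambda>Q. {X \<in> space (gauss_matrix k). \<not> Q X}"
  have events: "?N (passes t k) \<in> events" "?N (PERM T k) \<in> events" for t
    using measurable_passes[OF k, of t] measurable_PERM[of T k]
    by (simp_all add: pred_def sets.sets_Collect_neg)
  have "prob (?N (good k)) = prob (?N (passes Linearity k) \<union> ?N (passes Tail k) \<union> ?N (PERM T k))"
    by (rule arg_cong[where f = prob]) (auto simp: good_def)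
  also have "\<dots> \<le> prob (?N (passes Linearity k)) + prob (?N (passes Tail k)) + prob (?N (PERM T k))"
    using events by (intro order_trans[OF measure_Un_le] add_mono measure_Un_le) auto
  also have "\<dots> \<le> \<epsilon> / 3 + \<epsilon> / 2"
    using failure_prob_le[OF k] order_trans[OF prob_not_PERM_le[OF T_pos] Suc_div_T_power4_le[OF k]]
    unfolding failure_prob_def by (rule add_mono)
  also have "\<dots> \<le> \<epsilon>"
    using n_ge_1 \<delta>_pos c_pos by (simp add: field_simps)
  finally show ?thesis .
qed

lemma integral_ind_ge:
  assumes k: "k \<in> {1..n}"
  shows "(\<integral>X. ind n \<delta> c \<O> k X \<partial>gauss_matrix k) \<ge> 1 - \<epsilon>"
proof -
  interpret prob_space "gauss_matrix k" by (rule prob_space_gauss_matrix)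
  have "(\<integral>X. ind n \<delta> c \<O> k X \<partial>gauss_matrix k) =
      (\<integral>X. indicator {X \<in> space (gauss_matrix k). good k X} X \<partial>gauss_matrix k)"
    by (intro Bochner_Integration.integral_cong) (auto simp: ind_eq_good indicator_def)
  also have "\<dots> = prob {X \<in> space (gauss_matrix k). good k X}"
    by (simp add: Int_absorb2 subset_eq)
  also have "\<dots> = 1 - prob {X \<in> space (gauss_matrix k). \<not> good k X}"
    using prob_neg[of "good k"] measurable_good[OF k] by (simp add: pred_def)
  finally show ?thesis using prob_not_good_le[OF k] by simp
qed

lemma nn_integral_good_error_le:
  assumes "1 \<le> k" "k \<le> n"
  shows "(\<integral>\<^sup>+X. ennreal (of_bool (good k X) * (cmod (\<O> k X - Per k X))\<^sup>2) \<partial>gauss_matrix k) \<le>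
    ennreal ((2 * real n * real k * \<delta>)\<^sup>2 * fact k)"
  using assms
proof (induction k rule: dec_induct)
  case base
  interpret prob_space "gauss_matrix 1" by (rule prob_space_gauss_matrix)
  have "Per 1 X = X (1, 1)" for X
    by (simp add: Per_def)
  then have "(\<integral>\<^sup>+X. ennreal (of_bool (good 1 X) * (cmod (\<O> 1 X - Per 1 X))\<^sup>2) \<partial>gauss_matrix 1) \<le>
      (\<integral>\<^sup>+X. ennreal ((real n)\<^sup>2 * \<delta>\<^sup>2) \<partial>gauss_matrix 1)"
    by (intro nn_integral_mono ennreal_leI) (simp add: good_def passes_def LIN_def)
  also have "\<dots> \<le> ennreal ((2 * real n * real 1 * \<delta>)\<^sup>2 * fact 1)"
    using emeasure_space_1 by (auto intro!: ennreal_leI simp: power_mult_distrib)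
  finally show ?case .
next
  case (step m)
  then have m: "m \<in> {1..n}" "0 < m" by auto
  have "(\<integral>\<^sup>+X. ennreal (of_bool (good (Suc m) X) * (cmod (\<O> (Suc m) X - Per (Suc m) X))\<^sup>2)
      \<partial>gauss_matrix (Suc m)) \<le>
    ennreal (((real n * \<delta> + 2 * real n * real m * \<delta>)\<^sup>2 + real (Suc m) * \<epsilon> * (4 * T\<^sup>2)) *
      fact (Suc m))"
  proof (rule nn_integral_error_le[OF measurable_oracle measurable_good _ _ _ _ _ prob_not_good_le])
    show "0 < real n * \<delta>" "0 < 2 * real n * real m * \<delta>" "0 \<le> 4 * T\<^sup>2"
      using m \<delta>_pos by auto
    show "(\<integral>\<^sup>+Y. ennreal (of_bool (good m Y) * (cmod (\<O> m Y - Per m Y))\<^sup>2) \<partial>gauss_matrix m) \<le>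
        ennreal ((2 * real n * real m * \<delta>)\<^sup>2 * fact m)"
      using step by simp
    fix X assume "good (Suc m) X"
    then show "(cmod (\<O> (Suc m) X - row1_expansion (Suc m) (\<O> m) X))\<^sup>2 \<le>
        (real n * \<delta>)\<^sup>2 * fact (Suc m)"
      and "(cmod (\<O> (Suc m) X - Per (Suc m) X))\<^sup>2 \<le> 4 * T\<^sup>2 * fact (Suc m)"
      using LIN_Suc[OF m(2)] norm_diff_Per_le_of_TAIL_PERM
      by (auto simp: good_def passes_def simp del: fact_Suc)
  qed (use m in auto)
  also have "\<dots> \<le> ennreal ((2 * real n * real (Suc m) * \<delta>)\<^sup>2 * fact (Suc m))"
    using error_bound_Suc_le[OF m(1)] step.prems by (intro ennreal_leI mult_right_mono) simp_all
  finally show ?case .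
qed

lemma integral_ind_error_le:
  assumes "k \<in> {1..n}"
  shows "(\<integral>X. ind n \<delta> c \<O> k X * (cmod (\<O> k X - Per k X))\<^sup>2 \<partial>gauss_matrix k) \<le>
    (2 * real n * real k * \<delta>)\<^sup>2 * fact k"
  using assms nn_integral_good_error_le[of k]
  by (intro integral_real_bounded) (auto simp: ind_eq_good)

end

theorem mainTheorem4:
  "\<exists>C::real. C > 0 \<and>
    (\<forall>(n::nat) (\<delta>::real) (c::real) (\<O> :: nat \<Rightarrow> cmatrix \<Rightarrow> complex).
      0 < \<delta> \<longrightarrow> \<delta> \<le> 1 \<longrightarrow> 0 < c \<longrightarrow> c \<le> 1 \<longrightarrow>
      real n \<ge> C * sqrt (ln (1 / (\<delta> * c))) \<longrightarrow>
      (\<forall>k\<in>{1..n}. \<O> k \<in> borel_measurable (gauss_matrix k)) \<longrightarrow>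
      (\<forall>k\<in>{1..n}.
          (\<integral>X. ind n \<delta> c \<O> k X \<partial>gauss_matrix k) \<ge> 1 - \<delta> ^ 4 * c / (64 * real n) \<and>
          (\<integral>X. ind n \<delta> c \<O> k X * (cmod (\<O> k X - Per k X))\<^sup>2 \<partial>gauss_matrix k)
            \<le> (2 * real n * real k * \<delta>)\<^sup>2 * fact k) \<or>
      \<P>(\<omega> in PTest_samples n \<delta> c. PTest n \<delta> c \<O> \<omega> = Reject) \<ge> 1 - exp (- real n))"
proof (intro exI[of _ 1] conjI allI impI disjCI ballI)
  fix n :: nat and \<delta> c :: real and \<O> :: "nat \<Rightarrow> cmatrix \<Rightarrow> complex" and k
  assume "0 < \<delta>" "0 < c" "c \<le> 1" "\<forall>k\<in>{1..n}. \<O> k \<in> borel_measurable (gauss_matrix k)"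
    and "\<not> 1 - exp (- real n) \<le> \<P>(\<omega> in PTest_samples n \<delta> c. PTest n \<delta> c \<O> \<omega> = Reject)"
  then interpret PTest_rarely_rejecting n \<delta> c \<O>
    by unfold_locales auto
  assume k: "k \<in> {1..n}"
  show "(\<integral>X. ind n \<delta> c \<O> k X \<partial>gauss_matrix k) \<ge> 1 - \<delta> ^ 4 * c / (64 * real n)"
    using k by (rule integral_ind_ge)
  show "(\<integral>X. ind n \<delta> c \<O> k X * (cmod (\<O> k X - Per k X))\<^sup>2 \<partial>gauss_matrix k)
      \<le> (2 * real n * real k * \<delta>)\<^sup>2 * fact k"
    using k by (rule integral_ind_error_le)
qed simp

end
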